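(* Let $p>1$, $p'=p/(p-1)$, and let $(\mathcal{X},\mathcal{F},\{\mathcal{F}_n\}_{n\ge0},\mu)$ be a discrete-time filtered probability space. If $f\in L^p(\mathcal{X},\mathcal{F},\mu)$ and $\{\alpha_n\}_{n\ge0}$ is a Carleson sequence with constant $C$, then $$\mathbb{E}^\mu\Big[\sum_{n\ge0}\alpha_n|f_n|^p\Big]\le (p')^p\, C\,\mathbb{E}^\mu[|f|^p].$$ Moreover, if $\{\mathcal{F}_n\}_{n\ge0}$ is an infinitely refining filtration, then the constant $(p')^p$ is sharp: for every $K<(p')^p$ there exist $f\in L^p$ and a Carleson sequence $\{\alpha_n\}$ with some constant $C$ such that $\mathbb{E}^\mu[\sum_n\alpha_n|f_n|^p]>K\,C\,\mathbb{E}^\mu[|f|^p]$.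
   Context: A discrete-time filtration is a sequence of $\sigma$-fields $\{\emptyset,\mathcal{X}\}=\mathcal{F}_0\subseteq\mathcal{F}_1\subseteq\cdots\subseteq\mathcal{F}$. Write $f_n=\mathbb{E}^\mu[f\mid\mathcal{F}_n]$. A sequence of non-negative random variables $\{\alpha_n\}_{n\ge0}$ is a Carleson sequence (with constant $C$) if each $\alpha_n$ is $\mathcal{F}_n$-measurable and $\mathbb{E}^\mu[\sum_{k\ge n}\alpha_k\mid\mathcal{F}_n]\le C$ a.s. for every $n\ge0$. The filtration is infinitely refining if for every $\varepsilon>0$, every $n\ge0$ and every $E\in\mathcal{F}_n$ there exist $k>n$ and a real-valued $\mathcal{F}_k$-measurable random variable $h$ such that (i) $|h\mathbf{1}_E|=\mathbf{1}_E$ and (ii) $\int_E|h_n|\,d\mu\le\varepsilon$, where $h_n=\mathbb{E}^\mu[h\mid\mathcal{F}_n]$. *)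

theory Defs
  imports "HOL-Probability.Probability"
begin

definition discrete_filtration :: "'a measure \<Rightarrow> (nat \<Rightarrow> 'a measure) \<Rightarrow> bool" where
  "discrete_filtration M F \<longleftrightarrow>
     (\<forall>n. subalgebra M (F n)) \<and>
     (\<forall>n. sets (F n) \<subseteq> sets (F (Suc n))) \<and>
     sets (F 0) = {{}, space M}"

definition carleson_seq ::
  "'a measure \<Rightarrow> (nat \<Rightarrow> 'a measure) \<Rightarrow> (nat \<Rightarrow> 'a \<Rightarrow> real) \<Rightarrow> real \<Rightarrow> bool" where
  "carleson_seq M F \<alpha> C \<longleftrightarrow>
     (\<forall>n. \<alpha> n \<in> borel_measurable (F n)) \<and>
     (\<forall>n. \<forall>x\<in>space M. 0 \<le> \<alpha> n x) \<and>
     (\<forall>n. AE x in M.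
        enn2ereal (nn_cond_exp M (F n) (\<lambda>y. \<Sum>k. ennreal (\<alpha> (n + k) y)) x) \<le> ereal C)"

definition infinitely_refining :: "'a measure \<Rightarrow> (nat \<Rightarrow> 'a measure) \<Rightarrow> bool" where
  "infinitely_refining M F \<longleftrightarrow>
     (\<forall>\<epsilon>>0. \<forall>n. \<forall>E\<in>sets (F n). \<exists>k>n. \<exists>h::'a \<Rightarrow> real.
        h \<in> borel_measurable (F k) \<and> integrable M h \<and>
        (\<forall>x\<in>space M. \<bar>h x * indicator E x\<bar> = indicator E x) \<and>
        (\<integral>x\<in>E. \<bar>real_cond_exp M (F n) h x\<bar> \<partial>M) \<le> \<epsilon>)"

end

theory Submission
  imports Defs
begin

text \<open>
  Upper bound: replace \<open>\<bar>f\<^sub>n\<bar>\<close> by the running maximum \<open>g\<^sub>n\<close> of the \<open>\<bar>f\<^sub>k\<bar>\<close>. Summation by parts turns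
  \<open>\<Sum>\<^sub>n \<alpha>\<^sub>n g\<^sub>n\<^sup>p\<close> into a sum of the increments of \<open>g\<^sup>p\<close> against the tails of \<open>\<alpha>\<close>; conditioning
  bounds the tails by \<open>C\<close>, and Doob's maximal inequality finishes the proof.
  Doob's inequality follows from the pathwise bound of the increments of \<open>g\<^sup>p\<close> by \<open>p' \<bar>f\<^sub>n\<bar>\<close> times
  those of \<open>g\<^bsup>p-1\<^esup>\<close> and Young's inequality.

  Sharpness: infinite refinement yields a decreasing chain of events \<open>G\<^sub>j\<close>, known at times \<open>t\<^sub>j\<close>,
  that loses about the fraction \<open>\<delta>\<close> of its mass in every step. The indicators of the \<open>G\<^sub>j\<close> form a
  Carleson sequence with constant about \<open>1/\<delta>\<close>, and a truncation of the function equal to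
  \<open>\<mu>(G\<^sub>j)\<^bsup>-1/p\<^esup>\<close> on \<open>G\<^sub>j - G\<^sub>j\<^sub>+\<^sub>1\<close> (a discrete \<open>x\<^bsup>-1/p\<^esup>\<close>) has mean about
  \<open>p' \<mu>(G\<^sub>j)\<^bsup>-1/p\<^esup>\<close> over \<open>G\<^sub>j\<close>.
  The refinement is controlled only in \<open>L\<^sup>1\<close>, so the chain satisfies an almost sure upper bound on
  conditional probabilities (for the Carleson condition) but lower bounds only on total masses;
  by Jensen's inequality the latter suffice for the test function.
\<close>

section \<open>Inequalities for real powers\<close>

lemma powr_ge_tangent:
  fixes y c p :: real
  assumes "p > 1" "0 \<le> c"
  shows "p * c powr (p - 1) * y - (p - 1) * c powr p \<le> \<bar>y\<bar> powr p"
proof -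
  define q where "q = p / (p - 1)"
  have q_conjugate: "q > 1" "1 / p + 1 / q = 1" "(p - 1) * q = p"
    using assms by (auto simp: q_def field_simps)
  have "\<bar>y\<bar> * c powr (p - 1) \<le> \<bar>y\<bar> powr p / p + (c powr (p - 1)) powr q / q"
    using q_conjugate assms by (intro Youngs_inequality) auto
  also have "(c powr (p - 1)) powr q = c powr p"
    using q_conjugate by (simp add: powr_powr)
  also have "\<bar>y\<bar> powr p / p + c powr p / q = (\<bar>y\<bar> powr p + (p - 1) * c powr p) / p"
    using assms by (simp add: q_def field_simps)
  finally have "p * c powr (p - 1) * \<bar>y\<bar> \<le> \<bar>y\<bar> powr p + (p - 1) * c powr p"
    using assms by (simp add: field_simps)
  moreover have "p * c powr (p - 1) * y \<le> p * c powr (p - 1) * \<bar>y\<bar>"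
    using assms by (intro mult_left_mono) auto
  ultimately show ?thesis by linarith
qed

lemma powr_diff_le:
  fixes a b p :: real
  assumes "p > 1" "0 \<le> b" "0 \<le> a"
  shows "a powr p - b powr p \<le> p / (p - 1) * (a * (a powr (p - 1) - b powr (p - 1)))"
proof -
  define q where "q = p / (p - 1)"
  have q_conjugate: "q > 1" "(p - 1) * q = p" "(p - 1) * (q - 1) = 1"
    using assms by (auto simp: q_def field_simps)
  have "q * (a powr (p - 1)) powr (q - 1) * b powr (p - 1) - (q - 1) * (a powr (p - 1)) powr q
      \<le> \<bar>b powr (p - 1)\<bar> powr q"
    using q_conjugate by (intro powr_ge_tangent) auto
  then have "q * a * b powr (p - 1) - (q - 1) * a powr p \<le> b powr p"
    using q_conjugate assms by (simp add: powr_powr)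
  moreover have "a * a powr (p - 1) = a powr p"
    using assms by (simp add: powr_mult_base)
  ultimately show ?thesis
    unfolding q_def[symmetric] by (simp add: algebra_simps)
qed

lemma powr_diff_le_tangent:
  fixes a b s :: real
  assumes "0 < s" "s < 1" "0 \<le> a" "0 < b"
  shows "a powr s - b powr s \<le> s * (b powr (s - 1) * (a - b))"
proof -
  have "1 / s * (b powr s) powr (1 / s - 1) * a powr s - (1 / s - 1) * (b powr s) powr (1 / s)
      \<le> \<bar>a powr s\<bar> powr (1 / s)"
    using assms by (intro powr_ge_tangent) auto
  moreover have "s * (1 / s - 1) = 1 - s"
    using assms by (simp add: field_simps)
  ultimately have "1 / s * b powr (1 - s) * a powr s - (1 / s - 1) * b \<le> a"
    using assms by (simp add: powr_powr)
  then have "a powr s * b powr (1 - s) \<le> s * a + (1 - s) * b"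
    using assms by (simp add: field_simps)
  then have "a powr s * b powr (1 - s) * b powr (s - 1) \<le> (s * a + (1 - s) * b) * b powr (s - 1)"
    by (intro mult_right_mono) auto
  also have "a powr s * b powr (1 - s) * b powr (s - 1) = a powr s"
    using assms by (simp add: mult.assoc flip: powr_add)
  also have "(s * a + (1 - s) * b) * b powr (s - 1)
      = s * (b powr (s - 1) * (a - b)) + b * b powr (s - 1)"
    by (simp add: algebra_simps)
  also have "b * b powr (s - 1) = b powr s"
    using assms by (simp add: powr_mult_base)
  finally show ?thesis
    by simp
qed

lemma nn_integral_Youngs_inequality:
  fixes f g :: "'a \<Rightarrow> real"
  assumes conjugate: "p > 1" "q > 1" "1 / p + 1 / q = 1"
    and [measurable]: "f \<in> borel_measurable M" "g \<in> borel_measurable M"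
    and nonneg: "\<And>x. 0 \<le> f x" "\<And>x. 0 \<le> g x"
  shows "(\<integral>\<^sup>+x. ennreal (f x * g x) \<partial>M)
    \<le> ennreal (1 / p) * (\<integral>\<^sup>+x. ennreal (f x powr p) \<partial>M)
      + ennreal (1 / q) * (\<integral>\<^sup>+x. ennreal (g x powr q) \<partial>M)"
proof -
  have "ennreal (f x * g x)
      \<le> ennreal (1 / p) * ennreal (f x powr p) + ennreal (1 / q) * ennreal (g x powr q)" for x
    using Youngs_inequality[OF conjugate nonneg[of x]] conjugate
    by (simp add: ennreal_leI flip: ennreal_mult ennreal_plus)
  then have "(\<integral>\<^sup>+x. ennreal (f x * g x) \<partial>M)
      \<le> (\<integral>\<^sup>+x. ennreal (1 / p) * ennreal (f x powr p) + ennreal (1 / q) * ennreal (g x powr q) \<partial>M)"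
    by (rule nn_integral_mono)
  then show ?thesis
    by (simp add: nn_integral_add nn_integral_cmult)
qed

section \<open>Filtered measure spaces\<close>

lemma enn2ereal_le_ereal_iff: "enn2ereal x \<le> ereal r \<longleftrightarrow> 0 \<le> r \<and> x \<le> ennreal r"
proof (cases "0 \<le> r")
  case True
  then show ?thesis
    by (simp add: less_eq_ennreal.rep_eq)
next
  case False
  then have "ereal r < enn2ereal x"
    by (intro less_le_trans[OF _ enn2ereal_nonneg]) simp
  with False show ?thesis
    by simp
qed

context sigma_finite_subalgebra
begin

lemma nn_integral_mult_le_of_le_nn_cond_exp:
  assumes [measurable]: "w \<in> borel_measurable F" "g \<in> borel_measurable M"
    and dominated: "AE x in M. s x \<le> nn_cond_exp M F g x"
  shows "(\<integral>\<^sup>+x. w x * s x \<partial>M) \<le> (\<integral>\<^sup>+x. w x * g x \<partial>M)"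
proof -
  have "(\<integral>\<^sup>+x. w x * s x \<partial>M) \<le> (\<integral>\<^sup>+x. w x * nn_cond_exp M F g x \<partial>M)"
    using dominated by (intro nn_integral_mono_AE)
      (auto elim!: eventually_mono intro: mult_left_mono)
  then show ?thesis
    by (simp add: nn_cond_exp_intg)
qed

lemma nn_integral_mult_le_of_nn_cond_exp_le:
  assumes [measurable]: "w \<in> borel_measurable F" "g \<in> borel_measurable M"
    and bounded: "AE x in M. nn_cond_exp M F g x \<le> C"
  shows "(\<integral>\<^sup>+x. w x * g x \<partial>M) \<le> C * (\<integral>\<^sup>+x. w x \<partial>M)"
proof -
  have [measurable]: "w \<in> borel_measurable M"
    by (rule measurable_from_subalg[OF subalg assms(1)])
  have "(\<integral>\<^sup>+x. w x * g x \<partial>M) = (\<integral>\<^sup>+x. w x * nn_cond_exp M F g x \<partial>M)"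
    by (simp add: nn_cond_exp_intg)
  also have "\<dots> \<le> (\<integral>\<^sup>+x. C * w x \<partial>M)"
    using bounded by (intro nn_integral_mono_AE)
      (auto elim!: eventually_mono simp: mult.commute[of C] intro: mult_left_mono)
  finally show ?thesis
    by (simp add: nn_integral_cmult)
qed

end

lemma (in finite_measure_subalgebra) nn_cond_exp_le_const:
  assumes [measurable]: "g \<in> borel_measurable M"
    and "C \<noteq> \<infinity>"
    and averages_le: "\<And>D. D \<in> sets F \<Longrightarrow> (\<integral>\<^sup>+x\<in>D. g x \<partial>M) \<le> C * emeasure M D"
  shows "AE x in M. nn_cond_exp M F g x \<le> C"
proof (rule ccontr)
  assume not_le: "\<not> (AE x in M. nn_cond_exp M F g x \<le> C)"
  define D where "D = {x \<in> space F. C < nn_cond_exp M F g x}"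
  have D_event: "D \<in> sets F"
    unfolding D_def by measurable
  then have [measurable]: "D \<in> sets M" and space_F: "space F = space M"
    using subalg by (auto simp: subalgebra_def)
  have "(\<integral>\<^sup>+x\<in>D. C \<partial>M) < (\<integral>\<^sup>+x\<in>D. nn_cond_exp M F g x \<partial>M)"
  proof (rule nn_integral_less)
    show "\<not> (AE x in M. nn_cond_exp M F g x * indicator D x \<le> C * indicator D x)"
    proof
      assume "AE x in M. nn_cond_exp M F g x * indicator D x \<le> C * indicator D x"
      then have "AE x in M. nn_cond_exp M F g x \<le> C"
        using AE_space
        by eventually_elim (rule ccontr, simp add: D_def space_F)
      with not_le show False by simp
    qed
    show "(\<integral>\<^sup>+x\<in>D. C \<partial>M) \<noteq> \<infinity>"
      using \<open>C \<noteq> \<infinity>\<close>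
      by (simp add: nn_integral_cmult_indicator ennreal_mult_eq_top_iff emeasure_eq_measure)
    show "AE x in M. C * indicator D x \<le> nn_cond_exp M F g x * indicator D x"
      by (auto simp: D_def indicator_def)
  qed measurable
  also have "\<dots> = (\<integral>\<^sup>+x\<in>D. g x \<partial>M)"
    using nn_cond_exp_intg[of "indicator D" g] D_event by (simp add: mult.commute)
  also have "\<dots> \<le> (\<integral>\<^sup>+x\<in>D. C \<partial>M)"
    using averages_le[OF D_event] by (simp add: nn_integral_cmult)
  finally show False by simp
qed

locale filtered_finite_measure = finite_measure M for M :: "'a measure" +
  fixes F :: "nat \<Rightarrow> 'a measure"
  assumes subalgebra_F: "subalgebra M (F n)"
    and sets_F_Suc: "sets (F n) \<subseteq> sets (F (Suc n))"
begin

sublocale cond: finite_measure_subalgebra M "F n" for n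
  by unfold_locales (rule subalgebra_F)

lemma space_F: "space (F n) = space M"
  using subalgebra_F by (simp add: subalgebra_def)

lemma sets_F_M: "A \<in> sets (F n) \<Longrightarrow> A \<in> sets M"
  using subalgebra_F by (auto simp: subalgebra_def)

lemma measurable_F_M: "g \<in> measurable (F n) N \<Longrightarrow> g \<in> measurable M N"
  using subalgebra_F by (rule measurable_from_subalg)

lemma sets_F_mono: "m \<le> n \<Longrightarrow> sets (F m) \<subseteq> sets (F n)"
  using sets_F_Suc by (rule lift_Suc_mono_le)

lemma subalgebra_F_mono: "m \<le> n \<Longrightarrow> subalgebra (F n) (F m)"
  using sets_F_mono by (simp add: subalgebra_def space_F)

lemma nn_cond_exp_le_const_antimono:
  assumes "m \<le> n" and [measurable]: "g \<in> borel_measurable M"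
    and bounded: "AE x in M. nn_cond_exp M (F n) g x \<le> C"
  shows "AE x in M. nn_cond_exp M (F m) g x \<le> C"
proof -
  have "AE x in M. nn_cond_exp M (F m) g x = nn_cond_exp M (F m) (nn_cond_exp M (F n) g) x"
    using subalgebra_F subalgebra_F_mono[OF \<open>m \<le> n\<close>]
    by (intro cond.nn_cond_exp_nested_subalg) measurable
  moreover have "AE x in M. nn_cond_exp M (F m) (nn_cond_exp M (F n) g) x
      \<le> nn_cond_exp M (F m) (\<lambda>_. C) x"
    using bounded by (intro cond.nn_cond_exp_mono) measurable
  moreover have "AE x in M. C = nn_cond_exp M (F m) (\<lambda>_. C) x"
    by (intro cond.nn_cond_exp_F_meas) simp
  ultimately show ?thesis
    by eventually_elim simp
qed

lemma filtered_finite_measure_subseq: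
  assumes "strict_mono t"
  shows "filtered_finite_measure M (F \<circ> t)"
  using assms sets_F_mono subalgebra_F
  by unfold_locales (auto simp: strict_mono_less_eq)

end

lemma discrete_filtration_imp_filtered:
  assumes "prob_space M" "discrete_filtration M F"
  shows "filtered_finite_measure M F"
  using assms
  by (intro filtered_finite_measure.intro filtered_finite_measure_axioms.intro
      prob_space.finite_measure) (auto simp: discrete_filtration_def)

section \<open>Doob's maximal inequality\<close>

primrec running_max :: "(nat \<Rightarrow> real) \<Rightarrow> nat \<Rightarrow> real" where
  "running_max s 0 = 0"
| "running_max s (Suc n) = max (running_max s n) (s n)"

lemma running_max_nonneg: "0 \<le> running_max s n"
  by (induction n) auto

lemma running_max_le:
  assumes "\<And>k. s k \<le> B" "0 \<le> B"
  shows "running_max s n \<le> B"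
  using assms by (induction n) auto

lemma running_max_min:
  assumes "0 \<le> B"
  shows "running_max (\<lambda>k. min (s k) B) n = min (running_max s n) B"
  using assms by (induction n) auto

lemma measurable_running_max:
  assumes "\<And>k. k < n \<Longrightarrow> s k \<in> borel_measurable M"
  shows "(\<lambda>x. running_max (\<lambda>k. s k x) n) \<in> borel_measurable M"
  using assms by (induction n) auto

definition max_powr_increment :: "real \<Rightarrow> (nat \<Rightarrow> real) \<Rightarrow> nat \<Rightarrow> real" where
  "max_powr_increment r s k = running_max s (Suc k) powr r - running_max s k powr r"

lemma max_powr_increment_nonneg: "0 \<le> r \<Longrightarrow> 0 \<le> max_powr_increment r s k"
  using running_max_nonneg by (auto simp: max_powr_increment_def intro: powr_mono2)

lemma sum_max_powr_increment: "(\<Sum>k<n. max_powr_increment r s k) = running_max s n powr r"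
  unfolding max_powr_increment_def sum_lessThan_telescope[where f = "\<lambda>k. running_max s k powr r"]
  by simp

text \<open>The factor \<open>s k\<close> may replace the maximum because the maximum only grows when it is
  attained at \<open>k\<close>.\<close>
lemma max_powr_increment_le:
  assumes "p > 1" "0 \<le> s k"
  shows "max_powr_increment p s k \<le> p / (p - 1) * (s k * max_powr_increment (p - 1) s k)"
proof (cases "s k \<le> running_max s k")
  case True
  then show ?thesis
    by (simp add: max_powr_increment_def max_def)
next
  case False
  then show ?thesis
    using powr_diff_le[OF assms(1) running_max_nonneg assms(2)]
    by (simp add: max_powr_increment_def max_def)
qed

lemma running_max_powr_le:
  assumes "p > 1" "\<And>k. 0 \<le> s k"
  shows "running_max s n powr p \<le> p / (p - 1) * (\<Sum>k<n. s k * max_powr_increment (p - 1) s k)"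
  unfolding sum_distrib_left sum_max_powr_increment[of p, symmetric]
  using assms by (intro sum_mono max_powr_increment_le)

locale martingale_dominated = filtered_finite_measure +
  fixes s :: "nat \<Rightarrow> 'a \<Rightarrow> real" and \<phi> :: "'a \<Rightarrow> real"
  assumes adapted: "s k \<in> borel_measurable (F k)"
    and nonneg: "0 \<le> s k x"
    and dominating_measurable [measurable]: "\<phi> \<in> borel_measurable M"
    and dominating_nonneg: "0 \<le> \<phi> x"
    and dominated: "AE x in M. ennreal (s k x) \<le> nn_cond_exp M (F k) (\<lambda>x. ennreal (\<phi> x)) x"
begin

lemma measurable_M [measurable]: "s k \<in> borel_measurable M"
  using adapted by (rule measurable_F_M)

lemma measurable_running_max_M [measurable]:
  "(\<lambda>x. running_max (\<lambda>k. s k x) n) \<in> borel_measurable M"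
  by (rule measurable_running_max) measurable

lemma measurable_max_powr_increment [measurable]:
  "(\<lambda>x. max_powr_increment r (\<lambda>k. s k x) k) \<in> borel_measurable (F k)"
proof -
  have "s j \<in> borel_measurable (F k)" if "j \<le> k" for j
    using adapted measurable_from_subalg[OF subalgebra_F_mono[OF that]] by blast
  then have [measurable]: "(\<lambda>x. running_max (\<lambda>k. s k x) k) \<in> borel_measurable (F k)"
      "(\<lambda>x. running_max (\<lambda>k. s k x) (Suc k)) \<in> borel_measurable (F k)"
    by (intro measurable_running_max; simp)+
  show ?thesis
    unfolding max_powr_increment_def by measurable
qed

lemma measurable_M_max_powr_increment [measurable]:
  "(\<lambda>x. max_powr_increment r (\<lambda>k. s k x) k) \<in> borel_measurable M"
  using measurable_max_powr_increment by (rule measurable_F_M)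

lemma nn_integral_running_max_powr_le:
  assumes p_gt_1: "p > 1"
  shows "(\<integral>\<^sup>+x. ennreal (running_max (\<lambda>k. s k x) n powr p) \<partial>M)
    \<le> (\<integral>\<^sup>+x. ennreal (p / (p - 1) * \<phi> x * running_max (\<lambda>k. s k x) n powr (p - 1)) \<partial>M)"
proof -
  define e where "e = (\<lambda>k x. p / (p - 1) * max_powr_increment (p - 1) (\<lambda>k. s k x) k)"
  have e_nonneg: "0 \<le> e k x" for k x
    using p_gt_1 by (simp add: e_def max_powr_increment_nonneg)
  have [measurable]: "e k \<in> borel_measurable (F k)" "e k \<in> borel_measurable M" for k
    unfolding e_def by measurable
  have "(\<integral>\<^sup>+x. ennreal (running_max (\<lambda>k. s k x) n powr p) \<partial>M)
      \<le> (\<integral>\<^sup>+x. (\<Sum>k<n. ennreal (e k x) * ennreal (s k x)) \<partial>M)"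
  proof (rule nn_integral_mono)
    fix x
    have "running_max (\<lambda>k. s k x) n powr p \<le> (\<Sum>k<n. e k x * s k x)"
      using running_max_powr_le[OF p_gt_1, of "\<lambda>k. s k x" n] nonneg
      by (simp add: e_def sum_distrib_left ac_simps)
    then show "ennreal (running_max (\<lambda>k. s k x) n powr p)
        \<le> (\<Sum>k<n. ennreal (e k x) * ennreal (s k x))"
      using e_nonneg nonneg by (simp add: ennreal_leI flip: ennreal_mult)
  qed
  also have "\<dots> = (\<Sum>k<n. \<integral>\<^sup>+x. ennreal (e k x) * ennreal (s k x) \<partial>M)"
    by (rule nn_integral_sum) measurable
  also have "\<dots> \<le> (\<Sum>k<n. \<integral>\<^sup>+x. ennreal (e k x) * ennreal (\<phi> x) \<partial>M)"
    using dominated by (intro sum_mono cond.nn_integral_mult_le_of_le_nn_cond_exp) measurable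
  also have "\<dots> = (\<integral>\<^sup>+x. (\<Sum>k<n. ennreal (e k x) * ennreal (\<phi> x)) \<partial>M)"
    by (rule nn_integral_sum[symmetric]) measurable
  also have "\<dots> = (\<integral>\<^sup>+x. ennreal (p / (p - 1) * \<phi> x * running_max (\<lambda>k. s k x) n powr (p - 1)) \<partial>M)"
  proof (rule nn_integral_cong)
    fix x
    have "(\<Sum>k<n. ennreal (e k x) * ennreal (\<phi> x)) = ennreal (\<Sum>k<n. e k x * \<phi> x)"
      using e_nonneg dominating_nonneg by (simp flip: ennreal_mult)
    also have "(\<Sum>k<n. e k x * \<phi> x) = p / (p - 1) * \<phi> x * running_max (\<lambda>k. s k x) n powr (p - 1)"
      by (simp add: e_def sum_distrib_left ac_simps flip: sum_max_powr_increment)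
    finally show "(\<Sum>k<n. ennreal (e k x) * ennreal (\<phi> x))
        = ennreal (p / (p - 1) * \<phi> x * running_max (\<lambda>k. s k x) n powr (p - 1))" .
  qed
  finally show ?thesis .
qed

text \<open>Boundedness makes the integral on the left finite, so that the second term of
  Young's inequality can be absorbed.\<close>
lemma Doob_maximal_bounded:
  assumes p_gt_1: "p > 1" and bounded: "\<And>k x. s k x \<le> B" and B_nonneg: "0 \<le> B"
  shows "(\<integral>\<^sup>+x. ennreal (running_max (\<lambda>k. s k x) n powr p) \<partial>M)
    \<le> ennreal ((p / (p - 1)) powr p) * (\<integral>\<^sup>+x. ennreal (\<phi> x powr p) \<partial>M)"
    (is "?G \<le> ennreal (_ powr _) * ?\<Phi>")
proof (cases ?\<Phi>)
  case (real b)
  define q where "q = p / (p - 1)"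
  have q_conjugate: "q > 1" "1 / p + 1 / q = 1" "(p - 1) * q = p"
    using p_gt_1 by (auto simp: q_def field_simps)
  have "?G \<le> (\<integral>\<^sup>+x. ennreal (B powr p) \<partial>M)"
    using p_gt_1 bounded B_nonneg running_max_nonneg
    by (intro nn_integral_mono ennreal_leI powr_mono2 running_max_le) auto
  also have "\<dots> < \<infinity>"
    by (simp add: ennreal_mult_less_top emeasure_eq_measure)
  finally obtain a where G_eq: "?G = ennreal a" "0 \<le> a"
    by (cases ?G) auto
  have "?G \<le> (\<integral>\<^sup>+x. ennreal (q * \<phi> x * running_max (\<lambda>k. s k x) n powr (p - 1)) \<partial>M)"
    using nn_integral_running_max_powr_le[OF p_gt_1] by (simp add: q_def)
  also have "\<dots> \<le> ennreal (1 / p) * (\<integral>\<^sup>+x. ennreal ((q * \<phi> x) powr p) \<partial>M)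
      + ennreal (1 / q) * (\<integral>\<^sup>+x. ennreal ((running_max (\<lambda>k. s k x) n powr (p - 1)) powr q) \<partial>M)"
    using p_gt_1 q_conjugate dominating_nonneg by (intro nn_integral_Youngs_inequality) auto
  also have "\<dots> = ennreal (1 / p) * (ennreal (q powr p) * ?\<Phi>) + ennreal (1 / q) * ?G"
    using q_conjugate dominating_nonneg by (simp add: powr_powr powr_mult ennreal_mult
        nn_integral_cmult)
  also have "\<dots> = ennreal (q powr p / p * b + 1 / q * a)"
    using p_gt_1 q_conjugate G_eq real by (simp flip: ennreal_mult ennreal_plus)
  finally have "a \<le> q powr p / p * b + 1 / q * a"
    using p_gt_1 q_conjugate G_eq real by (simp add: ennreal_le_iff del: ennreal_plus)
  moreover have "1 / q = 1 - 1 / p"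
    using q_conjugate by simp
  ultimately have "a \<le> q powr p * b"
    using p_gt_1 by (simp add: field_simps)
  then show ?thesis
    using G_eq real by (simp add: q_def ennreal_leI flip: ennreal_mult)
next
  case top
  then show ?thesis
    using p_gt_1 by (simp add: ennreal_mult_top)
qed

theorem Doob_maximal:
  assumes p_gt_1: "p > 1"
  shows "(\<integral>\<^sup>+x. ennreal (running_max (\<lambda>k. s k x) n powr p) \<partial>M)
    \<le> ennreal ((p / (p - 1)) powr p) * (\<integral>\<^sup>+x. ennreal (\<phi> x powr p) \<partial>M)" (is "_ \<le> ?R")
proof -
  define g where "g = (\<lambda>(B::nat) x. ennreal (min (running_max (\<lambda>k. s k x) n) (real B) powr p))"
  have "(\<integral>\<^sup>+x. g B x \<partial>M) \<le> ?R" for B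
  proof -
    interpret truncated: martingale_dominated M F "\<lambda>k x. min (s k x) (real B)" \<phi>
    proof
      show "(\<lambda>x. min (s k x) (real B)) \<in> borel_measurable (F k)" for k
        using adapted by measurable
      show "AE x in M. ennreal (min (s k x) (real B))
          \<le> nn_cond_exp M (F k) (\<lambda>x. ennreal (\<phi> x)) x" for k
        using dominated[of k] by eventually_elim (rule order_trans[OF ennreal_leI], auto)
    qed (simp_all add: nonneg dominating_nonneg)
    show ?thesis
      using truncated.Doob_maximal_bounded[OF p_gt_1, of "real B" n]
      by (simp add: g_def running_max_min)
  qed
  moreover have "ennreal (running_max (\<lambda>k. s k x) n powr p) = (SUP B. g B x)" for x
  proof -
    obtain B where "running_max (\<lambda>k. s k x) n \<le> real B"
      using real_arch_simple by blast
    then have "ennreal (running_max (\<lambda>k. s k x) n powr p) = g B x"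
      by (simp add: g_def min_absorb1)
    moreover have "g B' x \<le> ennreal (running_max (\<lambda>k. s k x) n powr p)" for B'
      using p_gt_1 running_max_nonneg by (auto simp: g_def intro!: ennreal_leI powr_mono2)
    ultimately show ?thesis
      by (intro antisym SUP_least) (auto intro: SUP_upper)
  qed
  moreover have "(\<integral>\<^sup>+x. (SUP B. g B x) \<partial>M) = (SUP B. \<integral>\<^sup>+x. g B x \<partial>M)"
  proof (rule nn_integral_monotone_convergence_SUP)
    show "incseq g"
      using p_gt_1 running_max_nonneg
      by (auto simp: g_def incseq_def le_fun_def intro!: ennreal_leI powr_mono2)
    show "g B \<in> borel_measurable M" for B
      unfolding g_def by measurable
  qed
  ultimately show ?thesis
    by (simp add: SUP_le_iff)
qed

end

section \<open>The Carleson embedding inequality\<close>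

lemma suminf_mult_partial_sums:
  fixes a d :: "nat \<Rightarrow> ennreal"
  shows "(\<Sum>n. a n * (\<Sum>j\<le>n. d j)) = (\<Sum>j. d j * (\<Sum>k. a (j + k)))"
proof -
  define u where "u = (\<lambda>n j. if j \<le> n then a n * d j else 0)"
  have rows: "(\<Sum>j. u n j) = a n * (\<Sum>j\<le>n. d j)" for n
  proof -
    have "(\<Sum>j. u n j) = (\<Sum>j\<le>n. u n j)"
      by (rule suminf_finite) (auto simp: u_def)
    then show ?thesis by (simp add: u_def sum_distrib_left)
  qed
  have columns: "(\<Sum>n. u n j) = d j * (\<Sum>k. a (j + k))" for j
  proof -
    have "(\<Sum>n. u n j) = (\<Sum>k. u (j + k) j)"
      by (rule suminf_mono_reindex[symmetric])
        (auto simp: strict_mono_def u_def image_iff le_iff_add)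
    then show ?thesis by (simp add: u_def mult.commute)
  qed
  have "(\<Sum>n. \<Sum>j. u n j) = (\<integral>\<^sup>+n. (\<Sum>j. u n j) \<partial>count_space UNIV)"
    by (simp add: nn_integral_count_space_nat)
  also have "\<dots> = (\<Sum>j. \<integral>\<^sup>+n. u n j \<partial>count_space UNIV)"
    by (rule nn_integral_suminf) simp
  also have "\<dots> = (\<Sum>j. \<Sum>n. u n j)"
    by (simp add: nn_integral_count_space_nat)
  finally show ?thesis by (simp add: rows columns)
qed

theorem (in martingale_dominated) carleson_embedding_maximal:
  fixes \<alpha> :: "nat \<Rightarrow> 'a \<Rightarrow> ennreal"
  assumes p_gt_1: "p > 1"
    and [measurable]: "\<And>n. \<alpha> n \<in> borel_measurable M"
    and tails: "\<And>n. AE x in M. nn_cond_exp M (F n) (\<lambda>x. \<Sum>k. \<alpha> (n + k) x) x \<le> C"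
  shows "(\<integral>\<^sup>+x. (\<Sum>n. \<alpha> n x * ennreal (running_max (\<lambda>k. s k x) (Suc n) powr p)) \<partial>M)
    \<le> C * (ennreal ((p / (p - 1)) powr p) * (\<integral>\<^sup>+x. ennreal (\<phi> x powr p) \<partial>M))" (is "_ \<le> C * ?D")
proof -
  define d where "d = (\<lambda>k x. ennreal (max_powr_increment p (\<lambda>k. s k x) k))"
  have [measurable]: "d k \<in> borel_measurable (F k)" "d k \<in> borel_measurable M" for k
    unfolding d_def by measurable
  have sum_d: "(\<Sum>k<n. d k x) = ennreal (running_max (\<lambda>k. s k x) n powr p)" for n x
    using p_gt_1 by (simp add: d_def max_powr_increment_nonneg flip: sum_max_powr_increment)
  have "(\<integral>\<^sup>+x. (\<Sum>n. \<alpha> n x * ennreal (running_max (\<lambda>k. s k x) (Suc n) powr p)) \<partial>M)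
      = (\<integral>\<^sup>+x. (\<Sum>j. d j x * (\<Sum>k. \<alpha> (j + k) x)) \<partial>M)"
    by (simp only: lessThan_Suc_atMost suminf_mult_partial_sums flip: sum_d)
  also have "\<dots> = (\<Sum>j. \<integral>\<^sup>+x. d j x * (\<Sum>k. \<alpha> (j + k) x) \<partial>M)"
    by (rule nn_integral_suminf) measurable
  also have "\<dots> \<le> (\<Sum>j. C * (\<integral>\<^sup>+x. d j x \<partial>M))"
    using tails by (intro suminf_le cond.nn_integral_mult_le_of_nn_cond_exp_le) auto
  also have "\<dots> = C * (\<Sum>j. \<integral>\<^sup>+x. d j x \<partial>M)"
    by simp
  also have "(\<Sum>j. \<integral>\<^sup>+x. d j x \<partial>M) \<le> ?D"
  proof (rule suminf_le_const)
    show "(\<Sum>j<n. \<integral>\<^sup>+x. d j x \<partial>M) \<le> ?D" for n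
      using Doob_maximal[OF p_gt_1, of n] by (simp flip: nn_integral_sum sum_d)
  qed simp
  finally show ?thesis
    by (simp add: mult_left_mono)
qed

definition carleson_sum ::
  "'a measure \<Rightarrow> (nat \<Rightarrow> 'a measure) \<Rightarrow> (nat \<Rightarrow> 'a \<Rightarrow> real) \<Rightarrow> real \<Rightarrow> ('a \<Rightarrow> real) \<Rightarrow> ennreal" where
  "carleson_sum M F \<alpha> p f =
    (\<integral>\<^sup>+x. (\<Sum>n. ennreal (\<alpha> n x * \<bar>real_cond_exp M (F n) f x\<bar> powr p)) \<partial>M)"

lemma carleson_seq_iff:
  "carleson_seq M F \<alpha> C \<longleftrightarrow>
    (\<forall>n. \<alpha> n \<in> borel_measurable (F n)) \<and> (\<forall>n. \<forall>x\<in>space M. 0 \<le> \<alpha> n x) \<and>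
    (\<forall>n. AE x in M. 0 \<le> C \<and> nn_cond_exp M (F n) (\<lambda>y. \<Sum>k. ennreal (\<alpha> (n + k) y)) x \<le> ennreal C)"
  by (simp add: carleson_seq_def enn2ereal_le_ereal_iff)

theorem (in filtered_finite_measure) carleson_embedding:
  assumes p_gt_1: "p > 1" and [measurable]: "f \<in> borel_measurable M"
    and carleson_alpha: "carleson_seq M F \<alpha> C"
  shows "carleson_sum M F \<alpha> p f
    \<le> ennreal C * (ennreal ((p / (p - 1)) powr p) * (\<integral>\<^sup>+x. ennreal (\<bar>f x\<bar> powr p) \<partial>M))"
proof -
  interpret martingale_dominated M F "\<lambda>k x. \<bar>real_cond_exp M (F k) f x\<bar>" "\<lambda>x. \<bar>f x\<bar>"
    by unfold_locales (auto intro: cond.real_cond_exp_abs)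
  have alpha_nonneg: "x \<in> space M \<Longrightarrow> 0 \<le> \<alpha> n x"
    and alpha_adapted: "\<alpha> n \<in> borel_measurable (F n)" for n x
    using carleson_alpha by (auto simp: carleson_seq_iff)
  have [measurable]: "\<alpha> n \<in> borel_measurable M" for n
    using alpha_adapted by (rule measurable_F_M)
  have "carleson_sum M F \<alpha> p f \<le> (\<integral>\<^sup>+x. (\<Sum>n. ennreal (\<alpha> n x)
      * ennreal (running_max (\<lambda>k. \<bar>real_cond_exp M (F k) f x\<bar>) (Suc n) powr p)) \<partial>M)"
    unfolding carleson_sum_def
    using p_gt_1 alpha_nonneg
    by (intro nn_integral_mono suminf_le)
      (auto simp flip: ennreal_mult intro!: ennreal_leI mult_left_mono powr_mono2)
  also have "\<dots> \<le> ennreal C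
      * (ennreal ((p / (p - 1)) powr p) * (\<integral>\<^sup>+x. ennreal (\<bar>f x\<bar> powr p) \<partial>M))"
    using carleson_alpha by (intro carleson_embedding_maximal[OF p_gt_1])
      (auto simp: carleson_seq_iff elim: eventually_mono)
  finally show ?thesis .
qed

section \<open>Thinning events in an infinitely refining filtration\<close>

text \<open>Up to a factor of 2 in \<open>\<epsilon>\<close>, this says that the conditional expectations of \<open>1\<^sub>B\<close> and \<open>c 1\<^sub>A\<close>
  given \<open>N\<close> are \<open>\<epsilon>\<close>-close in \<open>L\<^sup>1\<close>.\<close>
definition uniform_fraction ::
  "'a measure \<Rightarrow> 'a measure \<Rightarrow> real \<Rightarrow> real \<Rightarrow> 'a set \<Rightarrow> 'a set \<Rightarrow> bool" where
  "uniform_fraction M N c \<epsilon> A B \<longleftrightarrow>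
    (\<forall>D\<in>sets N. \<bar>measure M (B \<inter> D) - c * measure M (A \<inter> D)\<bar> \<le> \<epsilon>)"

lemma uniform_fractionD:
  assumes "uniform_fraction M N c \<epsilon> A B" "D \<in> sets N"
  shows "\<bar>measure M (B \<inter> D) - c * measure M (A \<inter> D)\<bar> \<le> \<epsilon>"
  using assms by (simp add: uniform_fraction_def)

lemma uniform_fraction_mono:
  assumes "uniform_fraction M N c \<epsilon> A B" "\<epsilon> \<le> \<epsilon>'"
  shows "uniform_fraction M N c \<epsilon>' A B"
  using assms by (fastforce simp: uniform_fraction_def)

lemma uniform_fraction_trans:
  assumes fraction_AB: "uniform_fraction M N c \<epsilon> A B"
    and fraction_BC: "uniform_fraction M N' c' \<epsilon>' B C"
    and "sets N \<subseteq> sets N'" "0 \<le> c'"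
  shows "uniform_fraction M N (c' * c) (c' * \<epsilon> + \<epsilon>') A C"
  unfolding uniform_fraction_def
proof
  fix D assume D_event: "D \<in> sets N"
  have "\<bar>c' * (measure M (B \<inter> D) - c * measure M (A \<inter> D))\<bar> \<le> c' * \<epsilon>"
    unfolding abs_mult using uniform_fractionD[OF fraction_AB D_event] \<open>0 \<le> c'\<close>
    by (simp add: mult_left_mono)
  moreover have "\<bar>measure M (C \<inter> D) - c' * measure M (B \<inter> D)\<bar> \<le> \<epsilon>'"
    using uniform_fractionD[OF fraction_BC] D_event \<open>sets N \<subseteq> sets N'\<close> by auto
  ultimately show "\<bar>measure M (C \<inter> D) - c' * c * measure M (A \<inter> D)\<bar> \<le> c' * \<epsilon> + \<epsilon>'"
    by (simp add: right_diff_distrib mult.assoc)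
qed

lemma (in finite_measure) uniform_fraction_Diff:
  assumes fraction_AB: "uniform_fraction M N c \<epsilon> A B"
    and [measurable]: "A \<in> sets M" "B \<in> sets M" and "B \<subseteq> A" and sets_N_M: "sets N \<subseteq> sets M"
  shows "uniform_fraction M N (1 - c) \<epsilon> A (A - B)"
  unfolding uniform_fraction_def
proof
  fix D assume D_event: "D \<in> sets N"
  with sets_N_M have [measurable]: "D \<in> sets M" by auto
  have "measure M ((A - B) \<inter> D) = measure M (A \<inter> D) - measure M (B \<inter> D)"
    using \<open>B \<subseteq> A\<close> by (subst finite_measure_Diff[symmetric])
      (auto intro!: arg_cong[where f = "measure M"])
  then show "\<bar>measure M ((A - B) \<inter> D) - (1 - c) * measure M (A \<inter> D)\<bar> \<le> \<epsilon>"
    using uniform_fractionD[OF fraction_AB D_event] by (simp add: left_diff_distrib)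
qed

lemma (in finite_measure) set_integral_sign:
  fixes h :: "'a \<Rightarrow> real"
  assumes [measurable]: "h \<in> borel_measurable M" "A \<in> sets M" "D \<in> sets M"
    and sign: "\<And>x. x \<in> space M \<Longrightarrow> \<bar>h x * indicator A x\<bar> = indicator A x"
  shows "(\<integral>x\<in>A \<inter> D. h x \<partial>M) = 2 * measure M ({x \<in> A. h x = 1} \<inter> D) - measure M (A \<inter> D)"
proof -
  define B where "B = {x \<in> A. h x = 1}"
  have "A \<subseteq> space M"
    by (rule sets.sets_into_space) measurable
  then have "B = {x \<in> space M. x \<in> A \<and> h x = 1}"
    by (auto simp: B_def)
  then have [measurable]: "B \<in> sets M"
    by simp
  have "(\<integral>x\<in>A \<inter> D. h x \<partial>M) = (\<integral>x. 2 * indicator (B \<inter> D) x - indicator (A \<inter> D) x \<partial>M)"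
    unfolding set_lebesgue_integral_def
  proof (rule Bochner_Integration.integral_cong)
    fix x assume "x \<in> space M"
    from sign[OF this]
    show "indicator (A \<inter> D) x *\<^sub>R h x = 2 * indicator (B \<inter> D) x - indicator (A \<inter> D) x"
      by (auto simp: B_def indicator_def split: if_splits)
  qed simp
  also have "\<dots> = 2 * measure M (B \<inter> D) - measure M (A \<inter> D)"
    by (simp add: Bochner_Integration.integral_diff emeasure_eq_measure)
  finally show ?thesis
    by (simp add: B_def)
qed

lemma (in finite_measure_subalgebra) uniform_fraction_half:
  assumes int_h: "integrable M h" and A_event: "A \<in> sets F"
    and sign: "\<And>x. x \<in> space M \<Longrightarrow> \<bar>h x * indicator A x\<bar> = indicator A x"
  shows "uniform_fraction M F (1/2) (\<integral>x\<in>A. \<bar>real_cond_exp M F h x\<bar> \<partial>M) A {x \<in> A. h x = 1}"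
  unfolding uniform_fraction_def
proof
  define E where "E = real_cond_exp M F h"
  fix D assume D_event: "D \<in> sets F"
  have [measurable]: "A \<in> sets M" "D \<in> sets M"
    using A_event D_event subalg by (auto simp: subalgebra_def)
  have int_E: "set_integrable M X E" if "X \<in> sets M" for X
    unfolding set_integrable_def E_def
    using that real_cond_exp_int(1)[OF int_h] by (rule integrable_mult_indicator)
  have "2 * measure M ({x \<in> A. h x = 1} \<inter> D) - measure M (A \<inter> D) = (\<integral>x\<in>A \<inter> D. E x \<partial>M)"
    using set_integral_sign[OF _ _ _ sign, of D] real_cond_exp_intA[OF int_h, of "A \<inter> D"]
      int_h A_event D_event
    by (simp add: E_def)
  moreover have "\<bar>\<integral>x\<in>A \<inter> D. E x \<partial>M\<bar> \<le> (\<integral>x\<in>A \<inter> D. \<bar>E x\<bar> \<partial>M)"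
    using set_integral_norm_bound[OF int_E, of "A \<inter> D"] by simp
  moreover have "(\<integral>x\<in>A \<inter> D. \<bar>E x\<bar> \<partial>M) \<le> (\<integral>x\<in>A. \<bar>E x\<bar> \<partial>M)"
    unfolding set_lebesgue_integral_def
    by (intro integral_mono set_integrable_abs[OF int_E, unfolded set_integrable_def])
      (auto split: split_indicator)
  ultimately show "\<bar>measure M ({x \<in> A. h x = 1} \<inter> D) - 1/2 * measure M (A \<inter> D)\<bar>
      \<le> (\<integral>x\<in>A. \<bar>real_cond_exp M F h x\<bar> \<partial>M)"
    unfolding E_def by linarith
qed

lemma (in filtered_finite_measure) infinitely_refining_dyadic:
  assumes refining: "infinitely_refining M F" and A_event: "A \<in> sets (F n)" and "\<epsilon> > 0"
  shows "\<exists>k>n. \<exists>B\<in>sets (F k). B \<subseteq> A \<and> uniform_fraction M (F n) ((1/2) ^ r) \<epsilon> A B"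
  using \<open>\<epsilon> > 0\<close>
proof (induction r arbitrary: \<epsilon>)
  case 0
  then have "uniform_fraction M (F n) ((1/2) ^ 0) \<epsilon> A A"
    by (simp add: uniform_fraction_def)
  moreover have "A \<in> sets (F (Suc n))"
    using A_event sets_F_Suc by auto
  ultimately show ?case
    by blast
next
  case (Suc r)
  then obtain k B where later_k: "k > n" and B_event: "B \<in> sets (F k)" "B \<subseteq> A"
    and fraction_AB: "uniform_fraction M (F n) ((1/2) ^ r) \<epsilon> A B"
    by blast
  obtain l and h :: "'a \<Rightarrow> real" where later_l: "l > k"
    and [measurable]: "h \<in> borel_measurable (F l)"
    and int_h: "integrable M h"
    and sign: "\<And>x. x \<in> space M \<Longrightarrow> \<bar>h x * indicator B x\<bar> = indicator B x"
    and small: "(\<integral>x\<in>B. \<bar>real_cond_exp M (F k) h x\<bar> \<partial>M) \<le> \<epsilon> / 2"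
    using refining[unfolded infinitely_refining_def, rule_format,
        OF half_gt_zero[OF Suc.prems] B_event(1)]
    by blast
  have [measurable]: "B \<in> sets (F l)"
    using B_event sets_F_mono[of k l] later_l by auto
  have "uniform_fraction M (F k) (1/2) (\<epsilon> / 2) B {x \<in> B. h x = 1}"
    using cond.uniform_fraction_half[OF int_h B_event(1) sign] small
    by (auto intro: uniform_fraction_mono)
  then have "uniform_fraction M (F n) ((1/2) ^ Suc r) \<epsilon> A {x \<in> B. h x = 1}"
    using uniform_fraction_trans[OF fraction_AB _ sets_F_mono[of n k]] later_k by fastforce
  moreover have "{x \<in> B. h x = 1} \<in> sets (F l)"
    by measurable
  ultimately show ?case
    using later_k later_l B_event by (intro exI[of _ l] conjI bexI[of _ "{x \<in> B. h x = 1}"]) auto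
qed

definition thinning ::
  "'a measure \<Rightarrow> 'a measure \<Rightarrow> real \<Rightarrow> real \<Rightarrow> 'a set \<Rightarrow> 'a set \<Rightarrow> bool" where
  "thinning M N a b A B \<longleftrightarrow> B \<subseteq> A \<and> a * measure M A \<le> measure M B \<and>
    (\<forall>D\<in>sets N. measure M (B \<inter> D) \<le> b * measure M (A \<inter> D))"

lemma (in finite_measure) Hahn_decomposition_of_fraction:
  assumes subalgebra_N: "subalgebra M N" and A_event: "A \<in> sets N"
    and [measurable]: "B \<in> sets M" and "0 \<le> c"
  obtains G where "G \<in> sets N" "G \<subseteq> A"
    and "\<And>D. D \<in> sets N \<Longrightarrow> D \<subseteq> G \<Longrightarrow> measure M (B \<inter> D) \<le> c * measure M D"
    and "\<And>D. D \<in> sets N \<Longrightarrow> D \<subseteq> A - G \<Longrightarrow> c * measure M D \<le> measure M (B \<inter> D)"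
proof -
  define \<mu> where "\<mu> = restr_to_subalg (scale_measure (ennreal c) M) N"
  define \<nu> where "\<nu> = restr_to_subalg (density M (indicator B)) N"
  have subalg: "subalgebra (scale_measure (ennreal c) M) N" "subalgebra (density M (indicator B)) N"
    using subalgebra_N by (simp_all add: subalgebra_def space_scale_measure)
  then have sets_eq: "sets \<nu> = sets \<mu>" "sets \<mu> = sets N"
    by (simp_all add: \<mu>_def \<nu>_def sets_restr_to_subalg)
  have emeasure_mu: "emeasure \<mu> D = ennreal (c * measure M D)" if "D \<in> sets N" for D
    using that subalg \<open>0 \<le> c\<close>
    by (simp add: \<mu>_def emeasure_restr_to_subalg emeasure_eq_measure ennreal_mult)
  have emeasure_nu: "emeasure \<nu> D = ennreal (measure M (B \<inter> D))" if "D \<in> sets N" for D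
  proof -
    have "D \<in> sets M"
      using that subalgebra_N by (auto simp: subalgebra_def)
    then show ?thesis
      using that subalg
      by (simp add: \<nu>_def emeasure_restr_to_subalg emeasure_density emeasure_eq_measure
          flip: indicator_inter_arith)
  qed
  obtain G where "G \<in> sets N" "G \<subseteq> A"
    "\<forall>D\<in>sets N. D \<subseteq> G \<longrightarrow> emeasure \<nu> D \<le> emeasure \<mu> D"
    "\<forall>D\<in>sets N. D \<subseteq> A \<longrightarrow> D \<inter> G = {} \<longrightarrow> emeasure \<mu> D \<le> emeasure \<nu> D"
    using unsigned_Hahn_decomposition[OF sets_eq(1), of A] A_event
    by (auto simp: sets_eq emeasure_mu emeasure_nu)
  then show ?thesis
    using \<open>0 \<le> c\<close> by (intro that[of G]) (auto simp: emeasure_mu emeasure_nu Int_commute)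
qed

lemma uniform_fraction_excess_le:
  assumes fraction_AB: "uniform_fraction M N c \<eta> A B" and R_event: "R \<in> sets N" "R \<subseteq> A"
    and c_nonneg: "0 \<le> c" and eps_pos: "0 < \<epsilon>"
    and excess: "(c + \<epsilon>) * measure M R \<le> measure M (B \<inter> R)"
  shows "measure M (B \<inter> R) \<le> (1 + c / \<epsilon>) * \<eta>"
proof -
  have mass_BR_le: "measure M (B \<inter> R) \<le> c * measure M R + \<eta>"
    using uniform_fractionD[OF fraction_AB R_event(1)] R_event(2) by (simp add: Int_absorb1)
  with excess have "measure M R \<le> \<eta> / \<epsilon>"
    using eps_pos by (simp add: field_simps)
  then have "c * measure M R \<le> c * (\<eta> / \<epsilon>)"
    using c_nonneg by (rule mult_left_mono)
  with mass_BR_le show ?thesis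
    by (simp add: distrib_right)
qed

lemma (in finite_measure) thinning_of_uniform_fraction:
  assumes subalgebra_N: "subalgebra M N" and A_event: "A \<in> sets N"
    and [measurable]: "B \<in> sets M" and "B \<subseteq> A"
    and fraction_AB: "uniform_fraction M N c \<eta> A B"
    and c_nonneg: "0 \<le> c" and eps_pos: "0 < \<epsilon>" and eta_small: "(2 + c / \<epsilon>) * \<eta> \<le> \<epsilon> * measure M A"
  shows "\<exists>G\<in>sets N. thinning M N (c - \<epsilon>) (c + \<epsilon>) A (B \<inter> G)"
proof -
  have N_sets_M: "D \<in> sets M" if "D \<in> sets N" for D
    using that subalgebra_N by (auto simp: subalgebra_def)
  obtain G where G_event: "G \<in> sets N" "G \<subseteq> A"
    and upper: "\<And>D. D \<in> sets N \<Longrightarrow> D \<subseteq> G \<Longrightarrow> measure M (B \<inter> D) \<le> (c + \<epsilon>) * measure M D"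
    and lower: "\<And>D. D \<in> sets N \<Longrightarrow> D \<subseteq> A - G \<Longrightarrow> (c + \<epsilon>) * measure M D \<le> measure M (B \<inter> D)"
    using Hahn_decomposition_of_fraction[OF subalgebra_N A_event, of B "c + \<epsilon>"]
      c_nonneg eps_pos by auto
  note [measurable] = N_sets_M[OF A_event] N_sets_M[OF G_event(1)]
  have "measure M (B \<inter> G \<inter> D) \<le> (c + \<epsilon>) * measure M (A \<inter> D)" if "D \<in> sets N" for D
  proof -
    note [measurable] = N_sets_M[OF that]
    have "measure M (B \<inter> G \<inter> D) \<le> (c + \<epsilon>) * measure M (G \<inter> D)"
      using upper[of "G \<inter> D"] G_event that by (simp add: Int_assoc)
    also have "\<dots> \<le> (c + \<epsilon>) * measure M (A \<inter> D)"
      using G_event c_nonneg eps_pos by (intro mult_left_mono finite_measure_mono) auto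
    finally show ?thesis .
  qed
  moreover have "(c - \<epsilon>) * measure M A \<le> measure M (B \<inter> G)"
  proof -
    have remainder_event: "A - G \<in> sets N"
      using A_event G_event by auto
    have "measure M (B \<inter> (A - G)) \<le> (1 + c / \<epsilon>) * \<eta>"
      using uniform_fraction_excess_le[OF fraction_AB remainder_event _ c_nonneg eps_pos lower]
        remainder_event by auto
    moreover have "c * measure M A - \<eta> \<le> measure M B"
      using uniform_fractionD[OF fraction_AB A_event] \<open>B \<subseteq> A\<close> by (simp add: Int_absorb2)
    moreover have "measure M B = measure M (B \<inter> G) + measure M (B \<inter> (A - G))"
      using \<open>B \<subseteq> A\<close> by (subst finite_measure_Union[symmetric])
        (auto intro!: arg_cong[where f = "measure M"])
    ultimately show ?thesis
      using eta_small by (simp add: algebra_simps)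
  qed
  ultimately show ?thesis
    using G_event(1) \<open>B \<subseteq> A\<close> by (auto simp: thinning_def)
qed

lemma (in filtered_finite_measure) infinitely_refining_thinning:
  assumes refining: "infinitely_refining M F" and A_event: "A \<in> sets (F n)" "measure M A > 0"
    and eps_pos: "\<epsilon> > 0"
  shows "\<exists>k>n. \<exists>B\<in>sets (F k). thinning M (F n) (1 - (1/2) ^ r - \<epsilon>) (1 - (1/2) ^ r + \<epsilon>) A B"
proof -
  define c :: real where "c = 1 - (1/2) ^ r"
  have c_nonneg: "0 \<le> c"
    by (simp add: c_def power_le_one)
  define \<eta> where "\<eta> = \<epsilon> * measure M A / (2 + c / \<epsilon>)"
  have denominator_pos: "0 < 2 + c / \<epsilon>"
    using c_nonneg eps_pos by (simp add: add_pos_nonneg)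
  then have eta_small: "0 < \<eta>" "(2 + c / \<epsilon>) * \<eta> = \<epsilon> * measure M A"
    using A_event eps_pos by (simp_all add: \<eta>_def)
  obtain k B where later_k: "k > n" and B_event: "B \<in> sets (F k)" "B \<subseteq> A"
    and fraction_AB: "uniform_fraction M (F n) ((1/2) ^ r) \<eta> A B"
    using infinitely_refining_dyadic[OF refining A_event(1) eta_small(1)] by blast
  have [measurable]: "A \<in> sets (F k)"
    using A_event sets_F_mono[of n k] later_k by auto
  have "uniform_fraction M (F n) c \<eta> A (A - B)"
    unfolding c_def using fraction_AB A_event B_event sets_F_M subalgebra_F
    by (intro uniform_fraction_Diff) (auto simp: subalgebra_def)
  then obtain G where G_event: "G \<in> sets (F n)"
    and "thinning M (F n) (c - \<epsilon>) (c + \<epsilon>) A ((A - B) \<inter> G)"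
    using thinning_of_uniform_fraction[OF subalgebra_F A_event(1), of "A - B" c \<eta> \<epsilon>]
      A_event B_event c_nonneg eps_pos eta_small sets_F_M by auto
  moreover have "(A - B) \<inter> G \<in> sets (F k)"
    using A_event B_event G_event sets_F_mono[of n k] later_k by auto
  ultimately show ?thesis
    using later_k unfolding c_def by blast
qed

section \<open>Passing to a subsequence of times\<close>

definition spread :: "(nat \<Rightarrow> nat) \<Rightarrow> (nat \<Rightarrow> 'b::zero) \<Rightarrow> nat \<Rightarrow> 'b" where
  "spread t \<beta> n = (if n \<in> range t then \<beta> (inv t n) else 0)"

lemma spread_apply [simp]: "strict_mono t \<Longrightarrow> spread t \<beta> (t j) = \<beta> j"
  by (simp add: spread_def strict_mono_imp_inj_on)

lemma spread_outside [simp]: "n \<notin> range t \<Longrightarrow> spread t \<beta> n = 0"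
  by (simp add: spread_def)

lemma strict_mono_ge_iff:
  fixes t :: "nat \<Rightarrow> nat"
  assumes "strict_mono t"
  shows "\<exists>j\<^sub>0. \<forall>j. n \<le> t j \<longleftrightarrow> j\<^sub>0 \<le> j"
proof (intro exI allI iffI)
  have "n \<le> t (LEAST j. n \<le> t j)"
    using strict_mono_imp_increasing[OF assms] by (rule LeastI)
  then show "n \<le> t j" if "(LEAST j. n \<le> t j) \<le> j" for j
    using that assms by (meson order_trans strict_mono_less_eq)
qed (rule Least_le)

lemma suminf_spread_tail:
  fixes \<beta> :: "nat \<Rightarrow> real"
  assumes mono_t: "strict_mono t" and first_index: "\<And>j. n \<le> t j \<longleftrightarrow> j\<^sub>0 \<le> j"
  shows "(\<Sum>k. ennreal (spread t \<beta> (n + k))) = (\<Sum>i. ennreal (\<beta> (j\<^sub>0 + i)))"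
proof -
  have t_ge: "n \<le> t (j\<^sub>0 + i)" for i
    by (simp add: first_index)
  have "(\<Sum>k. ennreal (spread t \<beta> (n + k))) = (\<Sum>i. ennreal (spread t \<beta> (n + (t (j\<^sub>0 + i) - n))))"
  proof (rule suminf_mono_reindex[symmetric])
    show "strict_mono (\<lambda>i. t (j\<^sub>0 + i) - n)"
      using mono_t t_ge by (auto simp: strict_mono_def intro!: diff_less_mono)
    fix k assume "k \<notin> range (\<lambda>i. t (j\<^sub>0 + i) - n)"
    moreover have "k = t (j\<^sub>0 + (j - j\<^sub>0)) - n" if "n + k = t j" for j
      using that first_index[of j] by simp
    ultimately have "n + k \<notin> range t"
      by blast
    then show "ennreal (spread t \<beta> (n + k)) = 0"
      by simp
  qed
  then show ?thesis
    using mono_t t_ge by simp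
qed

lemma carleson_sum_spread:
  assumes "strict_mono t"
  shows "carleson_sum M F (\<lambda>n x. spread t (\<lambda>j. \<beta> j x) n) p f = carleson_sum M (F \<circ> t) \<beta> p f"
proof -
  have "(\<Sum>n. ennreal (spread t (\<lambda>j. \<beta> j x) n * \<bar>real_cond_exp M (F n) f x\<bar> powr p))
      = (\<Sum>j. ennreal (\<beta> j x * \<bar>real_cond_exp M (F (t j)) f x\<bar> powr p))" for x
    using suminf_mono_reindex[OF assms,
        of "\<lambda>n. ennreal (spread t (\<lambda>j. \<beta> j x) n * \<bar>real_cond_exp M (F n) f x\<bar> powr p)"] assms
    by simp
  then show ?thesis
    by (simp add: carleson_sum_def)
qed

lemma (in filtered_finite_measure) carleson_seq_spread:
  assumes mono_t: "strict_mono t" and carleson_beta: "carleson_seq M (F \<circ> t) \<beta> C"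
  shows "carleson_seq M F (\<lambda>n x. spread t (\<lambda>j. \<beta> j x) n) C"
  unfolding carleson_seq_iff
proof (intro conjI allI ballI)
  have beta_adapted: "\<beta> j \<in> borel_measurable (F (t j))" for j
    using carleson_beta by (simp add: carleson_seq_iff)
  have [measurable]: "\<beta> j \<in> borel_measurable M" for j
    using beta_adapted by (rule measurable_F_M)
  fix n
  show "(\<lambda>x. spread t (\<lambda>j. \<beta> j x) n) \<in> borel_measurable (F n)"
    using beta_adapted mono_t by (cases "n \<in> range t") auto
  show "0 \<le> spread t (\<lambda>j. \<beta> j x) n" if "x \<in> space M" for x
    using carleson_beta that mono_t by (cases "n \<in> range t") (auto simp: carleson_seq_iff)
  obtain j where first_index: "\<And>i. n \<le> t i \<longleftrightarrow> j \<le> i"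
    using strict_mono_ge_iff[OF mono_t, of n] by blast
  define T where "T = (\<lambda>x. \<Sum>i. ennreal (\<beta> (j + i) x))"
  have [measurable]: "T \<in> borel_measurable M"
    unfolding T_def by measurable
  have "AE x in M. 0 \<le> C \<and> nn_cond_exp M (F (t j)) T x \<le> ennreal C"
    using carleson_beta by (auto simp: carleson_seq_iff T_def)
  then have "AE x in M. 0 \<le> C \<and> nn_cond_exp M (F n) T x \<le> ennreal C"
    using nn_cond_exp_le_const_antimono[of n "t j" T "ennreal C"] first_index by auto
  then show "AE x in M. 0 \<le> C
      \<and> nn_cond_exp M (F n) (\<lambda>x. \<Sum>k. ennreal (spread t (\<lambda>j. \<beta> j x) (n + k))) x \<le> ennreal C"
    by (simp add: T_def suminf_spread_tail[OF mono_t first_index])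
qed

section \<open>Step functions along a decreasing sequence of events\<close>

definition staircase ::
  "(nat \<Rightarrow> 'a set) \<Rightarrow> (nat \<Rightarrow> real) \<Rightarrow> real \<Rightarrow> nat \<Rightarrow> 'a \<Rightarrow> real" where
  "staircase G v w N x = (\<Sum>i<N. v i * indicator (G i - G (Suc i)) x) + w * indicator (G N) x"

lemma staircase_Suc:
  assumes "G (Suc N) \<subseteq> G N"
  shows "staircase G v w (Suc N) x = staircase G v (if x \<in> G (Suc N) then w else v N) N x"
  using assms by (auto simp: staircase_def indicator_def)

lemma staircase_comp:
  assumes decreasing: "\<And>i. G (Suc i) \<subseteq> G i" and "g 0 = 0"
  shows "g (staircase G v w N x) = staircase G (\<lambda>i. g (v i)) (g w) N x"
proof (induction N arbitrary: w)
  case 0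
  show ?case
    using \<open>g 0 = 0\<close> by (simp add: staircase_def indicator_def)
next
  case (Suc N)
  then show ?case
    using decreasing by (simp add: staircase_Suc)
qed

lemma measurable_staircase [measurable]:
  assumes [measurable]: "\<And>i. G i \<in> sets M"
  shows "staircase G v w N \<in> borel_measurable M"
  unfolding staircase_def[abs_def] by measurable

context finite_measure
begin

lemma integrable_staircase:
  assumes [measurable]: "\<And>i. G i \<in> sets M"
  shows "integrable M (staircase G v w N)"
  unfolding staircase_def[abs_def]
  by (intro Bochner_Integration.integrable_add Bochner_Integration.integrable_sum
      integrable_mult_right integrable_real_indicator) (auto simp: emeasure_eq_measure)

lemma set_integral_staircase:
  assumes [measurable]: "\<And>i. G i \<in> sets M" "A \<in> sets M"
  shows "(\<integral>x\<in>A. staircase G v w N x \<partial>M)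
    = (\<Sum>i<N. v i * measure M (A \<inter> (G i - G (Suc i)))) + w * measure M (A \<inter> G N)"
proof -
  have "indicator A x *\<^sub>R staircase G v w N x
      = (\<Sum>i<N. v i * indicator (A \<inter> (G i - G (Suc i))) x) + w * indicator (A \<inter> G N) x" for x
    unfolding staircase_def indicator_inter_arith
    by (simp add: distrib_left sum_distrib_left mult.left_commute del: sum_mult_indicator)
  then show ?thesis
    unfolding set_lebesgue_integral_def
    by (simp add: Bochner_Integration.integral_add Bochner_Integration.integral_sum
        emeasure_eq_measure del: sum_mult_indicator)
qed

text \<open>Jensen's inequality, by integrating the tangent of \<open>y\<^sup>p\<close> at \<open>c\<close> over \<open>A\<close>.\<close>
lemma nn_set_integral_powr_ge:
  assumes p_gt_1: "p > 1" and c_nonneg: "0 \<le> c" and [measurable]: "A \<in> sets M"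
    and int_h: "integrable M h" and mean: "c * measure M A \<le> (\<integral>x\<in>A. h x \<partial>M)"
  shows "ennreal (c powr p * measure M A) \<le> (\<integral>\<^sup>+x\<in>A. ennreal (\<bar>h x\<bar> powr p) \<partial>M)"
proof -
  define l where "l = (\<lambda>x. p * c powr (p - 1) * (indicator A x * h x)
    - (p - 1) * c powr p * indicator A x)"
  have int_Ah: "integrable M (\<lambda>x. indicator A x * h x)"
    using integrable_mult_indicator[OF _ int_h, of A] by simp
  have int_l: "integrable M l"
    unfolding l_def using int_Ah
    by (intro Bochner_Integration.integrable_diff integrable_mult_right integrable_real_indicator)
      (auto simp: emeasure_eq_measure)
  have "c powr p * measure M A
      = p * c powr (p - 1) * (c * measure M A) - (p - 1) * c powr p * measure M A"
    using powr_mult_base[OF c_nonneg, of "p - 1"] by (simp add: algebra_simps)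
  also have "\<dots> \<le> p * c powr (p - 1) * (\<integral>x\<in>A. h x \<partial>M) - (p - 1) * c powr p * measure M A"
    using p_gt_1 mean by (intro diff_right_mono mult_left_mono) auto
  also have "\<dots> = (\<integral>x. l x \<partial>M)"
    unfolding l_def set_lebesgue_integral_def using int_Ah
    by (simp add: Bochner_Integration.integral_diff emeasure_eq_measure)
  also have "\<dots> \<le> (\<integral>x. max 0 (l x) \<partial>M)"
    using int_l by (intro integral_mono) auto
  finally have "ennreal (c powr p * measure M A) \<le> ennreal (\<integral>x. max 0 (l x) \<partial>M)"
    by (rule ennreal_leI)
  also have "\<dots> = (\<integral>\<^sup>+x. ennreal (max 0 (l x)) \<partial>M)"
    using int_l by (intro nn_integral_eq_integral[symmetric]) auto
  also have "\<dots> \<le> (\<integral>\<^sup>+x\<in>A. ennreal (\<bar>h x\<bar> powr p) \<partial>M)"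
    using powr_ge_tangent[OF p_gt_1 c_nonneg]
    by (intro nn_integral_mono) (auto simp: l_def indicator_def intro: ennreal_leI)
  finally show ?thesis .
qed

end

section \<open>Sharpness of the constant\<close>

locale thinning_chain = filtered_finite_measure +
  fixes G :: "nat \<Rightarrow> 'a set" and a b :: real
  assumes G_sets: "G j \<in> sets (F j)"
    and thinning_G: "thinning M (F j) a b (G j) (G (Suc j))"
    and G_0_pos: "0 < measure M (G 0)"
    and a_pos: "0 < a" and b_less_1: "b < 1"
begin

abbreviation mass :: "nat \<Rightarrow> real" where
  "mass j \<equiv> measure M (G j)"

lemma G_sets_M [measurable]: "G j \<in> sets M"
  using G_sets by (rule sets_F_M)

lemma G_Suc: "G (Suc j) \<subseteq> G j"
  using thinning_G by (simp add: thinning_def)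

lemma G_antimono: "i \<le> j \<Longrightarrow> G j \<subseteq> G i"
  using G_Suc by (rule lift_Suc_antimono_le)

lemma mass_Suc_ge: "a * mass j \<le> mass (Suc j)"
  using thinning_G by (simp add: thinning_def)

lemma mass_Suc_le: "mass (Suc j) \<le> mass j"
  using G_Suc by (intro finite_measure_mono) auto

lemma mass_Int_Suc_le: "D \<in> sets (F j) \<Longrightarrow> measure M (G (Suc j) \<inter> D) \<le> b * measure M (G j \<inter> D)"
  using thinning_G by (simp add: thinning_def)

lemma mass_pos: "0 < mass j"
proof (induction j)
  case (Suc j)
  then have "0 < a * mass j"
    using a_pos by simp
  then show ?case
    using mass_Suc_ge[of j] by linarith
qed (rule G_0_pos)

lemma a_le_b: "a \<le> b"
proof -
  have "a * mass 0 \<le> mass (Suc 0)"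
    by (rule mass_Suc_ge)
  also have "\<dots> \<le> b * mass 0"
    using mass_Int_Suc_le[OF G_sets, of 0] G_Suc[of 0] by (simp add: Int_absorb2)
  finally show ?thesis
    using G_0_pos by simp
qed

lemma mass_Int_add_le:
  assumes D_event: "D \<in> sets (F n)"
  shows "measure M (G (n + k) \<inter> D) \<le> b ^ k * measure M D"
proof (induction k)
  case 0
  show ?case
    using D_event sets_F_M by (auto intro!: finite_measure_mono)
next
  case (Suc k)
  have "D \<in> sets (F (n + k))"
    using D_event sets_F_mono[of n "n + k"] by auto
  then have "measure M (G (n + Suc k) \<inter> D) \<le> b * measure M (G (n + k) \<inter> D)"
    using mass_Int_Suc_le[of D "n + k"] by simp
  also have "\<dots> \<le> b * (b ^ k * measure M D)"
    using a_pos a_le_b Suc by (intro mult_left_mono) auto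
  finally show ?case by simp
qed

lemma carleson_seq_indicator: "carleson_seq M F (\<lambda>j. indicator (G j)) (1 / (1 - b))"
proof -
  have b_bounds: "0 \<le> b" "b < 1"
    using a_pos a_le_b b_less_1 by auto
  have "AE x in M. nn_cond_exp M (F n) (\<lambda>x. \<Sum>k. ennreal (indicator (G (n + k)) x)) x
      \<le> ennreal (1 / (1 - b))" for n
  proof (rule cond.nn_cond_exp_le_const)
    fix D assume D_event: "D \<in> sets (F n)"
    note [measurable] = sets_F_M[OF D_event]
    have "(\<integral>\<^sup>+x\<in>D. (\<Sum>k. ennreal (indicator (G (n + k)) x)) \<partial>M)
        = (\<integral>\<^sup>+x. (\<Sum>k. indicator (G (n + k) \<inter> D) x) \<partial>M)"
      by (simp add: indicator_inter_arith ennreal_indicator)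
    also have "\<dots> = (\<Sum>k. ennreal (measure M (G (n + k) \<inter> D)))"
      by (subst nn_integral_suminf) (auto simp: emeasure_eq_measure)
    also have "\<dots> \<le> (\<Sum>k. ennreal (b ^ k * measure M D))"
      using mass_Int_add_le[OF D_event] by (intro suminf_le ennreal_leI) auto
    also have "\<dots> = ennreal (\<Sum>k. b ^ k * measure M D)"
      using b_bounds by (intro suminf_ennreal2 summable_mult2) auto
    also have "(\<Sum>k. b ^ k * measure M D) = 1 / (1 - b) * measure M D"
      using b_bounds by (subst suminf_mult2[symmetric]) (auto simp: suminf_geometric)
    also have "ennreal \<dots> = ennreal (1 / (1 - b)) * emeasure M D"
      using b_bounds by (subst ennreal_mult) (auto simp: emeasure_eq_measure)
    finally show "(\<integral>\<^sup>+x\<in>D. (\<Sum>k. ennreal (indicator (G (n + k)) x)) \<partial>M)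
        \<le> ennreal (1 / (1 - b)) * emeasure M D" .
  qed (auto simp: emeasure_eq_measure)
  then show ?thesis
    using b_bounds G_sets by (simp add: carleson_seq_iff)
qed

definition extremal :: "real \<Rightarrow> nat \<Rightarrow> 'a \<Rightarrow> real" where
  "extremal p N =
    staircase G (\<lambda>i. mass i powr (-1/p)) (p / (p - 1) * mass N powr (-1/p)) N"

lemma measurable_extremal [measurable]: "extremal p N \<in> borel_measurable M"
  unfolding extremal_def by measurable

lemma integrable_extremal: "integrable M (extremal p N)"
  unfolding extremal_def by (intro integrable_staircase) measurable

lemma extremal_powr:
  assumes "p > 1"
  shows "\<bar>extremal p N x\<bar> powr p
    = staircase G (\<lambda>i. 1 / mass i) ((p / (p - 1)) powr p / mass N) N x"
proof -
  have coeff_powr: "\<bar>mass i powr (-1/p)\<bar> powr p = 1 / mass i" for i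
    using assms mass_pos[of i] by (simp add: powr_powr powr_neg_one)
  have "\<bar>p / (p - 1) * mass N powr (-1/p)\<bar> powr p
      = (p / (p - 1)) powr p * \<bar>mass N powr (-1/p)\<bar> powr p"
    using assms by (simp only: abs_mult powr_mult abs_ge_zero) simp
  also have "\<dots> = (p / (p - 1)) powr p / mass N"
    by (simp only: coeff_powr) simp
  finally have last_coeff_powr:
    "\<bar>p / (p - 1) * mass N powr (-1/p)\<bar> powr p = (p / (p - 1)) powr p / mass N" .
  show ?thesis
    unfolding extremal_def
    by (subst staircase_comp[where g = "\<lambda>y. \<bar>y\<bar> powr p"])
      (simp_all only: G_Suc coeff_powr last_coeff_powr, simp)
qed

lemma integrable_extremal_powr: "p > 1 \<Longrightarrow> integrable M (\<lambda>x. \<bar>extremal p N x\<bar> powr p)"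
  by (simp only: extremal_powr) (intro integrable_staircase G_sets_M)

lemma integral_extremal_powr_le:
  assumes "p > 1"
  shows "(\<integral>x. \<bar>extremal p N x\<bar> powr p \<partial>M) \<le> real N * (1 - a) + (p / (p - 1)) powr p"
proof -
  have G_M: "G i \<subseteq> space M" for i
    by (rule sets.sets_into_space) measurable
  have "(\<integral>x. \<bar>extremal p N x\<bar> powr p \<partial>M)
      = (\<integral>x\<in>space M. staircase G (\<lambda>i. 1 / mass i) ((p / (p - 1)) powr p / mass N) N x \<partial>M)"
    using assms by (simp add: extremal_powr set_integral_space integrable_staircase)
  also have "\<dots> = (\<Sum>i<N. (1 / mass i) * (mass i - mass (Suc i))) + (p / (p - 1)) powr p"
    using mass_pos[of N] G_Suc
    by (simp add: set_integral_staircase finite_measure_Diff Int_absorb1 G_M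
        Diff_subset[THEN order_trans])
  also have "\<dots> \<le> (\<Sum>i<N. 1 - a) + (p / (p - 1)) powr p"
  proof (intro add_right_mono sum_mono)
    fix i
    show "(1 / mass i) * (mass i - mass (Suc i)) \<le> 1 - a"
      using mass_Suc_ge[of i] mass_pos[of i] by (simp add: field_simps)
  qed
  finally show ?thesis by simp
qed

lemma mass_powr_increment_le:
  assumes p_gt_1: "p > 1"
  shows "a powr (1/p) * (p / (p - 1)) * (mass i powr (1 - 1/p) - mass (Suc i) powr (1 - 1/p))
    \<le> mass i powr (-1/p) * (mass i - mass (Suc i))"
proof -
  have "mass i powr (1 - 1/p) - mass (Suc i) powr (1 - 1/p)
      \<le> (1 - 1/p) * (mass (Suc i) powr (1 - 1/p - 1) * (mass i - mass (Suc i)))"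
    using p_gt_1 mass_pos by (intro powr_diff_le_tangent) auto
  also have "\<dots> = (p - 1) / p * (mass (Suc i) powr (-1/p) * (mass i - mass (Suc i)))"
    using p_gt_1 by (simp add: field_simps)
  also have "\<dots> \<le> (p - 1) / p * ((a * mass i) powr (-1/p) * (mass i - mass (Suc i)))"
    using p_gt_1 a_pos mass_pos[of i] mass_Suc_ge[of i] mass_Suc_le[of i]
    by (intro mult_left_mono mult_right_mono powr_mono2') auto
  finally have "p / (p - 1) * (mass i powr (1 - 1/p) - mass (Suc i) powr (1 - 1/p))
      \<le> (a * mass i) powr (-1/p) * (mass i - mass (Suc i))"
    using p_gt_1 by (simp add: field_simps)
  then have "a powr (1/p) * (p / (p - 1) * (mass i powr (1 - 1/p) - mass (Suc i) powr (1 - 1/p)))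
      \<le> a powr (1/p) * ((a * mass i) powr (-1/p) * (mass i - mass (Suc i)))"
    by (rule mult_left_mono) simp
  also have "a powr (1/p) * (a * mass i) powr (-1/p) = mass i powr (-1/p)"
    using a_pos mass_pos[of i] by (simp add: powr_mult powr_minus)
  then have "a powr (1/p) * ((a * mass i) powr (-1/p) * (mass i - mass (Suc i)))
      = mass i powr (-1/p) * (mass i - mass (Suc i))"
    by (metis mult.assoc)
  finally show ?thesis
    by (simp only: mult.assoc)
qed

lemma measure_G_Int_Diff:
  "measure M (G j \<inter> (G i - G (Suc i))) = (if j \<le> i then mass i - mass (Suc i) else 0)"
proof (cases "j \<le> i")
  case True
  then have "G j \<inter> (G i - G (Suc i)) = G i - G (Suc i)"
    using G_antimono by blast
  then show ?thesis
    using True G_Suc by (simp add: finite_measure_Diff)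
next
  case False
  then have "G j \<inter> (G i - G (Suc i)) = {}"
    using G_antimono[of "Suc i" j] by auto
  with False show ?thesis by simp
qed

lemma set_integral_extremal_ge:
  assumes p_gt_1: "p > 1" and j_le_N: "j \<le> N"
  shows "a powr (1/p) * (p / (p - 1)) * mass j powr (1 - 1/p) \<le> (\<integral>x\<in>G j. extremal p N x \<partial>M)"
proof -
  define \<kappa> where "\<kappa> = a powr (1/p) * (p / (p - 1))"
  define \<sigma> where "\<sigma> = (\<lambda>i. mass i powr (1 - 1/p))"
  have "a powr (1/p) \<le> 1"
    using a_pos a_le_b b_less_1 p_gt_1 by (intro powr_le1) auto
  then have "\<kappa> \<le> p / (p - 1)"
    using p_gt_1 unfolding \<kappa>_def by (intro mult_left_le_one_le) auto
  have "\<kappa> * \<sigma> j = (\<Sum>i=j..<N. \<kappa> * (\<sigma> i - \<sigma> (Suc i))) + \<kappa> * \<sigma> N"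
    using sum_Suc_diff'[OF j_le_N, of "\<lambda>i. - \<sigma> i"] by (simp flip: sum_distrib_left distrib_left)
  also have "\<dots> \<le> (\<Sum>i=j..<N. mass i powr (-1/p) * (mass i - mass (Suc i))) + p / (p - 1) * \<sigma> N"
    unfolding \<kappa>_def \<sigma>_def
    using mass_powr_increment_le[OF p_gt_1] \<open>\<kappa> \<le> p / (p - 1)\<close>[unfolded \<kappa>_def]
    by (intro add_mono sum_mono mult_right_mono) auto
  also have "(\<Sum>i=j..<N. mass i powr (-1/p) * (mass i - mass (Suc i)))
      = (\<Sum>i<N. mass i powr (-1/p) * measure M (G j \<inter> (G i - G (Suc i))))"
    by (rule sum.mono_neutral_cong_left) (auto simp: measure_G_Int_Diff)
  also have "p / (p - 1) * \<sigma> N = p / (p - 1) * mass N powr (-1/p) * measure M (G j \<inter> G N)"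
    using powr_mult_base[of "mass N" "-1/p"] G_antimono[OF j_le_N]
    by (simp add: \<sigma>_def Int_absorb1 mult.commute)
  finally show ?thesis
    by (simp only: \<kappa>_def \<sigma>_def extremal_def set_integral_staircase G_sets_M)
qed

lemma nn_set_integral_cond_exp_extremal_ge:
  assumes p_gt_1: "p > 1" and j_le_N: "j \<le> N"
  shows "ennreal (a * (p / (p - 1)) powr p)
    \<le> (\<integral>\<^sup>+x\<in>G j. ennreal (\<bar>real_cond_exp M (F j) (extremal p N) x\<bar> powr p) \<partial>M)"
proof -
  define c where "c = a powr (1/p) * (p / (p - 1)) * mass j powr (-1/p)"
  have c_nonneg: "0 \<le> c"
    using p_gt_1 by (simp add: c_def)
  have "c * mass j = a powr (1/p) * (p / (p - 1)) * mass j powr (1 - 1/p)"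
    using powr_mult_base[of "mass j" "-1/p"] by (simp add: c_def mult.commute mult.left_commute)
  also have "\<dots> \<le> (\<integral>x\<in>G j. extremal p N x \<partial>M)"
    using p_gt_1 j_le_N by (rule set_integral_extremal_ge)
  also have "\<dots> = (\<integral>x\<in>G j. real_cond_exp M (F j) (extremal p N) x \<partial>M)"
    using integrable_extremal G_sets by (rule cond.real_cond_exp_intA)
  finally have "ennreal (c powr p * mass j)
      \<le> (\<integral>\<^sup>+x\<in>G j. ennreal (\<bar>real_cond_exp M (F j) (extremal p N) x\<bar> powr p) \<partial>M)"
    using p_gt_1 c_nonneg cond.real_cond_exp_int(1)[OF integrable_extremal]
    by (intro nn_set_integral_powr_ge) measurable
  moreover have
    "c powr p = (a powr (1/p)) powr p * (p / (p - 1)) powr p * (mass j powr (-1/p)) powr p"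
    using p_gt_1 unfolding c_def by (simp only: powr_mult)
  then have "c powr p * mass j = a * (p / (p - 1)) powr p"
    using p_gt_1 a_pos mass_pos[of j] by (simp add: powr_powr powr_neg_one)
  ultimately show ?thesis by simp
qed

lemma carleson_sum_extremal_ge:
  assumes p_gt_1: "p > 1"
  shows "ennreal ((real N + 1) * (a * (p / (p - 1)) powr p))
    \<le> carleson_sum M F (\<lambda>j. indicator (G j)) p (extremal p N)"
proof -
  define u where "u = (\<lambda>j x.
    ennreal (indicator (G j) x * \<bar>real_cond_exp M (F j) (extremal p N) x\<bar> powr p))"
  have u_eq: "u j x
      = ennreal (\<bar>real_cond_exp M (F j) (extremal p N) x\<bar> powr p) * indicator (G j) x" for j x
    by (simp add: u_def indicator_def)
  have "ennreal ((real N + 1) * (a * (p / (p - 1)) powr p))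
      = (\<Sum>j\<le>N. ennreal (a * (p / (p - 1)) powr p))"
    using a_pos by (subst sum_ennreal) auto
  also have "\<dots> \<le> (\<Sum>j\<le>N. \<integral>\<^sup>+x. u j x \<partial>M)"
    unfolding u_eq by (intro sum_mono nn_set_integral_cond_exp_extremal_ge p_gt_1) simp
  also have "\<dots> \<le> (\<Sum>j. \<integral>\<^sup>+x. u j x \<partial>M)"
    by (intro sum_le_suminf) auto
  also have "\<dots> = (\<integral>\<^sup>+x. (\<Sum>j. u j x) \<partial>M)"
    unfolding u_def by (rule nn_integral_suminf[symmetric]) measurable
  finally show ?thesis
    by (simp add: carleson_sum_def u_def)
qed

lemma extremal_exceeds:
  assumes p_gt_1: "p > 1" and K_nonneg: "0 \<le> K"
    and gain: "K * (1 - a) < a * (p / (p - 1)) powr p * (1 - b)"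
  obtains N where "ennreal (K * (1 / (1 - b)) * (\<integral>x. \<bar>extremal p N x\<bar> powr p \<partial>M))
    < carleson_sum M F (\<lambda>j. indicator (G j)) p (extremal p N)"
proof -
  define P where "P = (p / (p - 1)) powr p"
  have "0 < a * P * (1 - b) - K * (1 - a)"
    using gain by (simp add: P_def)
  then obtain N :: nat where "K * P < real N * (a * P * (1 - b) - K * (1 - a))"
    using reals_Archimedean3 by blast
  moreover have "0 \<le> a * P * (1 - b)"
    using a_pos b_less_1 by (simp add: P_def)
  ultimately have N_large: "K * (real N * (1 - a) + P) < (real N + 1) * (a * P) * (1 - b)"
    by (simp add: algebra_simps)
  have "K * (\<integral>x. \<bar>extremal p N x\<bar> powr p \<partial>M) \<le> K * (real N * (1 - a) + P)"
    using K_nonneg integral_extremal_powr_le[OF p_gt_1] by (simp add: P_def mult_left_mono)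
  also note N_large
  finally have "K * (1 / (1 - b)) * (\<integral>x. \<bar>extremal p N x\<bar> powr p \<partial>M) < (real N + 1) * (a * P)"
    using b_less_1 by (simp add: divide_less_eq)
  then have "ennreal (K * (1 / (1 - b)) * (\<integral>x. \<bar>extremal p N x\<bar> powr p \<partial>M))
      < ennreal ((real N + 1) * (a * P))"
    using K_nonneg b_less_1 by (intro ennreal_lessI) (auto intro: le_less_trans[rotated])
  also have "\<dots> \<le> carleson_sum M F (\<lambda>j. indicator (G j)) p (extremal p N)"
    unfolding P_def using p_gt_1 by (rule carleson_sum_extremal_ge)
  finally show ?thesis
    by (rule that)
qed

end

lemma (in filtered_finite_measure) infinitely_refining_chain:
  assumes refining: "infinitely_refining M F" and "0 < measure M (space M)"
    and a_eq_pos: "a = 1 - (1/2) ^ r - \<epsilon>" "0 < a"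
    and b_eq_less_1: "b = 1 - (1/2) ^ r + \<epsilon>" "b < 1" and eps_pos: "0 < \<epsilon>"
  obtains t G where "strict_mono t" "thinning_chain M (F \<circ> t) G a b"
proof -
  define P where "P = (\<lambda>(n, A). A \<in> sets (F n) \<and> 0 < measure M A)"
  define Q where "Q = (\<lambda>(n, A) (k, B). n < k \<and> thinning M (F n) a b A B)"
  have "\<exists>z. \<forall>j. P (z j) \<and> Q (z j) (z (Suc j))"
  proof (rule dependent_nat_choice)
    have "space M \<in> sets (F 0)"
      using sets.top[of "F 0"] by (simp add: space_F)
    with assms(2) show "\<exists>x. P x"
      by (intro exI[of _ "(0, space M)"]) (simp add: P_def)
  next
    fix x and j :: nat assume "P x"
    then obtain n A where x_eq: "x = (n, A)" and A_event: "A \<in> sets (F n)" "0 < measure M A"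
      by (auto simp: P_def)
    obtain k B where "k > n" "B \<in> sets (F k)" and thinning_B: "thinning M (F n) a b A B"
      using infinitely_refining_thinning[OF refining A_event eps_pos, of r]
      unfolding a_eq_pos b_eq_less_1 by blast
    moreover have "0 < measure M B"
      using thinning_B mult_pos_pos[OF \<open>0 < a\<close> A_event(2)] by (simp add: thinning_def)
    ultimately show "\<exists>y. P y \<and> Q x y"
      by (intro exI[of _ "(k, B)"]) (simp add: P_def Q_def x_eq)
  qed
  then obtain z where chain: "P (z j)" "Q (z j) (z (Suc j))" for j
    by blast
  define t where "t = fst \<circ> z"
  define G where "G = snd \<circ> z"
  have "strict_mono t"
    using chain(2) by (auto simp: t_def strict_mono_Suc_iff Q_def case_prod_unfold)
  moreover have "thinning_chain M (F \<circ> t) G a b"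
    using chain \<open>0 < a\<close> \<open>b < 1\<close> filtered_finite_measure_subseq[OF \<open>strict_mono t\<close>]
    by (intro thinning_chain.intro thinning_chain_axioms.intro)
      (auto simp: P_def Q_def t_def G_def case_prod_unfold)
  ultimately show ?thesis
    by (rule that)
qed

text \<open>The error \<open>\<epsilon> = \<delta>\<^sup>2\<close> is negligible against \<open>\<delta> = (1/2)\<^sup>r\<close>, so that \<open>(1 - b) / (1 - a)\<close>
  tends to \<open>1\<close>.\<close>
lemma thinning_ratios_exist:
  fixes K P :: real
  assumes "K < P"
  obtains r :: nat and a b \<epsilon> :: real
  where "a = 1 - (1/2) ^ r - \<epsilon>" "0 < a" "b = 1 - (1/2) ^ r + \<epsilon>" "b < 1" "0 < \<epsilon>"
    "K * (1 - a) < a * P * (1 - b)"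
proof -
  have power_tendsto_0: "(\<lambda>r. (1/2) ^ r :: real) \<longlonglongrightarrow> 0"
    by (rule LIMSEQ_realpow_zero) auto
  have "(\<lambda>r. (1 - (1/2) ^ r - ((1/2) ^ r)\<^sup>2) * P * (1 - (1/2) ^ r) - K * (1 + (1/2) ^ r))
      \<longlonglongrightarrow> (1 - 0 - 0\<^sup>2) * P * (1 - 0) - K * (1 + 0)"
    by (intro tendsto_intros power_tendsto_0)
  then have "\<forall>\<^sub>F r in sequentially.
      0 < (1 - (1/2) ^ r - ((1/2) ^ r)\<^sup>2) * P * (1 - (1/2) ^ r) - K * (1 + (1/2) ^ r)"
    by (rule order_tendstoD) (use \<open>K < P\<close> in simp)
  moreover have "\<forall>\<^sub>F r in sequentially. (1/2) ^ r < (1/2 :: real)"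
    by (rule order_tendstoD[OF power_tendsto_0]) simp
  ultimately have "\<forall>\<^sub>F r in sequentially. (1/2) ^ r < (1/2 :: real) \<and>
      0 < (1 - (1/2) ^ r - ((1/2) ^ r)\<^sup>2) * P * (1 - (1/2) ^ r) - K * (1 + (1/2) ^ r)"
    by eventually_elim simp
  then obtain r :: nat and \<delta> :: real where \<delta>_def: "\<delta> = (1/2) ^ r" and "\<delta> < 1/2"
      and gain: "0 < (1 - \<delta> - \<delta>\<^sup>2) * P * (1 - \<delta>) - K * (1 + \<delta>)"
    using eventually_happens'[OF sequentially_bot] by blast
  have "0 < \<delta>"
    by (simp add: \<delta>_def)
  moreover from this have "\<delta>\<^sup>2 < \<delta> / 2"
    using \<open>\<delta> < 1/2\<close> by (simp add: power2_eq_square)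
  ultimately have delta_bounds: "0 < \<delta>" "\<delta>\<^sup>2 < \<delta>" "\<delta> + \<delta>\<^sup>2 < 1"
    using \<open>\<delta> < 1/2\<close> by linarith+
  have "0 < \<delta> * ((1 - \<delta> - \<delta>\<^sup>2) * P * (1 - \<delta>) - K * (1 + \<delta>))"
    using delta_bounds(1) gain by (rule mult_pos_pos)
  then have "K * (1 - (1 - \<delta> - \<delta>\<^sup>2)) < (1 - \<delta> - \<delta>\<^sup>2) * P * (1 - (1 - \<delta> + \<delta>\<^sup>2))"
    by (simp add: algebra_simps power2_eq_square)
  then show ?thesis
    using delta_bounds
    by (intro that[of "1 - \<delta> - \<delta>\<^sup>2" r "\<delta>\<^sup>2" "1 - \<delta> + \<delta>\<^sup>2"]) (simp_all add: \<delta>_def)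
qed

theorem (in filtered_finite_measure) carleson_embedding_sharp:
  assumes p_gt_1: "p > 1" and refining: "infinitely_refining M F"
    and total_mass_pos: "0 < measure M (space M)"
    and K_less: "K < (p / (p - 1)) powr p"
  obtains f \<alpha> C where "f \<in> borel_measurable M" "integrable M (\<lambda>x. \<bar>f x\<bar> powr p)"
    "carleson_seq M F \<alpha> C" "ennreal (K * C * (\<integral>x. \<bar>f x\<bar> powr p \<partial>M)) < carleson_sum M F \<alpha> p f"
proof -
  define K\<^sub>0 where "K\<^sub>0 = max K 0"
  have "K\<^sub>0 < (p / (p - 1)) powr p"
    using K_less p_gt_1 by (simp add: K\<^sub>0_def)
  then obtain r :: nat and a b \<epsilon> :: real where ratios: "a = 1 - (1/2) ^ r - \<epsilon>" "0 < a"
      "b = 1 - (1/2) ^ r + \<epsilon>" "b < 1" "0 < \<epsilon>"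
    and gain: "K\<^sub>0 * (1 - a) < a * (p / (p - 1)) powr p * (1 - b)"
    by (rule thinning_ratios_exist)
  obtain t G where mono_t: "strict_mono t" and "thinning_chain M (F \<circ> t) G a b"
    using infinitely_refining_chain[OF refining total_mass_pos ratios] .
  then interpret chain: thinning_chain M "F \<circ> t" G a b
    by simp
  obtain N where "ennreal (K\<^sub>0 * (1 / (1 - b)) * (\<integral>x. \<bar>chain.extremal p N x\<bar> powr p \<partial>M))
      < carleson_sum M (F \<circ> t) (\<lambda>j. indicator (G j)) p (chain.extremal p N)"
    using chain.extremal_exceeds[OF p_gt_1 _ gain] by (auto simp: K\<^sub>0_def)
  moreover have "K * (1 / (1 - b)) * (\<integral>x. \<bar>chain.extremal p N x\<bar> powr p \<partial>M)
      \<le> K\<^sub>0 * (1 / (1 - b)) * (\<integral>x. \<bar>chain.extremal p N x\<bar> powr p \<partial>M)"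
    using \<open>b < 1\<close> by (intro mult_right_mono) (auto simp: K\<^sub>0_def)
  ultimately have "ennreal (K * (1 / (1 - b)) * (\<integral>x. \<bar>chain.extremal p N x\<bar> powr p \<partial>M))
      < carleson_sum M F (\<lambda>n x. spread t (\<lambda>j. indicator (G j) x) n) p (chain.extremal p N)"
    unfolding carleson_sum_spread[OF mono_t] by (meson ennreal_leI order_le_less_trans)
  then show ?thesis
    by (rule that[OF chain.measurable_extremal chain.integrable_extremal_powr[OF p_gt_1]
          carleson_seq_spread[OF mono_t chain.carleson_seq_indicator]])
qed

theorem theorem1p3:
  fixes M :: "'a measure" and F :: "nat \<Rightarrow> 'a measure" and p :: real
  assumes "prob_space M"
    and "discrete_filtration M F"
    and "p > 1"
  shows "(\<forall>(f::'a \<Rightarrow> real) \<alpha> C.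
            f \<in> borel_measurable M \<longrightarrow> integrable M (\<lambda>x. \<bar>f x\<bar> powr p) \<longrightarrow>
            carleson_seq M F \<alpha> C \<longrightarrow>
            enn2ereal (\<integral>\<^sup>+ x. (\<Sum>n. ennreal (\<alpha> n x * \<bar>real_cond_exp M (F n) f x\<bar> powr p)) \<partial>M)
              \<le> ereal ((p / (p - 1)) powr p * C * (\<integral>x. \<bar>f x\<bar> powr p \<partial>M)))
       \<and> (infinitely_refining M F \<longrightarrow>
            (\<forall>K::real. K < (p / (p - 1)) powr p \<longrightarrow>
              (\<exists>(f::'a \<Rightarrow> real) \<alpha> C.
                 f \<in> borel_measurable M \<and> integrable M (\<lambda>x. \<bar>f x\<bar> powr p) \<and>
                 carleson_seq M F \<alpha> C \<and>
                 enn2ereal (\<integral>\<^sup>+ x. (\<Sum>n. ennreal (\<alpha> n x * \<bar>real_cond_exp M (F n) f x\<bar> powr p)) \<partial>M)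
                   > ereal (K * C * (\<integral>x. \<bar>f x\<bar> powr p \<partial>M)))))"
proof -
  interpret prob_space M by fact
  interpret filtered_finite_measure M F
    using assms(1,2) by (rule discrete_filtration_imp_filtered)
  have total_mass_pos: "0 < measure M (space M)"
    by (simp add: prob_space)
  show ?thesis
    unfolding carleson_sum_def[symmetric]
  proof (intro conjI allI impI)
    fix f :: "'a \<Rightarrow> real" and \<alpha> C
    assume f_Lp: "f \<in> borel_measurable M" "integrable M (\<lambda>x. \<bar>f x\<bar> powr p)"
      and carleson_alpha: "carleson_seq M F \<alpha> C"
    then have "0 \<le> C"
      by (simp add: carleson_seq_iff)
    then show "enn2ereal (carleson_sum M F \<alpha> p f)
        \<le> ereal ((p / (p - 1)) powr p * C * (\<integral>x. \<bar>f x\<bar> powr p \<partial>M))"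
      using carleson_embedding[OF \<open>p > 1\<close> f_Lp(1) carleson_alpha] f_Lp(2)
      by (simp add: enn2ereal_le_ereal_iff nn_integral_eq_integral ac_simps flip: ennreal_mult)
  next
    fix K assume "infinitely_refining M F" "K < (p / (p - 1)) powr p"
    then show "\<exists>(f::'a \<Rightarrow> real) \<alpha> C. f \<in> borel_measurable M \<and>
        integrable M (\<lambda>x. \<bar>f x\<bar> powr p) \<and> carleson_seq M F \<alpha> C \<and>
        ereal (K * C * (\<integral>x. \<bar>f x\<bar> powr p \<partial>M)) < enn2ereal (carleson_sum M F \<alpha> p f)"
      by (rule carleson_embedding_sharp[OF \<open>p > 1\<close> _ total_mass_pos])
        (metis enn2ereal_le_ereal_iff not_le)
  qed
qed

end
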